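(* Let $(G,u)$ be a unital $\ell$-group having a basis $\mathcal B$ with $\bigwedge\mathcal B\neq 0$, and suppose that at least one of the multiplicities of $\mathcal B$ is equal to $1$. Then $(G,u)$ is projective.
   Context: A lattice-ordered abelian group ($\ell$-group) is a structure $(G,+,-,0,\vee,\wedge)$ such that $(G,+,-,0)$ is an abelian group, $(G,\vee,\wedge)$ is a lattice, and $x+(y\vee z)=(x+y)\vee(x+z)$ for all $x,y,z\in G$. An order-unit is an element $u\in G$ such that for every $g\in G$ there is $n\in\{1,2,\ldots\}$ with $g\le nu$. A unital $\ell$-group $(G,u)$ is an $\ell$-group $G$ with a distinguished order-unit $u$. Morphisms of unital $\ell$-groups are unital $\ell$-homomorphisms, i.e. maps $h\colon(G,u)\to(G',u')$ preserving the group and lattice structure with $h(u)=u'$. An ideal of $(G,u)$ is the kernel of a unital $\ell$-homomorphism of $(G,u)$. $\mathrm{MaxSpec}(G)$ is the set of maximal (proper) ideals of $(G,u)$ with the spectral topology: a basis of closed sets is given by the sets $\{\mathfrak p\in\mathrm{MaxSpec}(G)\mid a\in\mathfrak p\}$, $a\in G$. Basis: a basis of $(G,u)$ is a set $\mathcal B=\{b_1,\ldots,b_n\}$ of nonzero elements of the positive cone $G^+=\{g\in G\mid g\ge 0\}$ such that (i) $\mathcal B$ generates $G$ (as an $\ell$-group); (ii) for each $k=1,2,\ldots$ and each $k$-element subset $C$ of $\mathcal B$ with $\bigwedge\{b\mid b\in C\}\neq 0$, the set $\{\mathfrak m\in\mathrm{MaxSpec}(G)\mid \mathfrak m\supseteq\mathcal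 B\setminus C\}$ is homeomorphic to a $(k-1)$-simplex; (iii) there are integers $m_1,\ldots,m_n\ge 1$ such that $\sum_{i=1}^n m_ib_i=u$. The integer $m_i$, which is uniquely determined by (ii)-(iii), is called the multiplicity of $b_i$. Projective: $(G,u)$ is projective if whenever $\psi\colon(A,a)\to(B,b)$ is a surjective morphism of unital $\ell$-groups and $\phi\colon(G,u)\to(B,b)$ is a morphism, there is a morphism $\theta\colon(G,u)\to(A,a)$ such that $\phi=\psi\circ\theta$. *)

theory Defs
  imports "HOL-Homology.Homology"
begin

section \<open>Lattice-ordered abelian groups with order-unit\<close>

text \<open>
  Following HOL-Algebra, the abelian group underlying an \<open>\<ell>\<close>-group is written multiplicatively:
  \<open>x + y\<close>, \<open>0\<close>, \<open>- x\<close> and \<open>n x\<close> are rendered as \<open>x \<otimes> y\<close>, \<open>\<one>\<close>, \<open>inv x\<close> and \<open>x [^] n\<close>.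
\<close>

record 'a lgroup = "'a monoid" +
  leq :: "'a \<Rightarrow> 'a \<Rightarrow> bool"

definition lattice_of :: "'a lgroup \<Rightarrow> 'a gorder" where
  "lattice_of G = \<lparr>carrier = carrier G, eq = (=), le = leq G\<rparr>"

locale lgroup = comm_group G + order: lattice "lattice_of G"
  for G :: "'a lgroup" (structure) +
  assumes mult_join_distrib:
    "\<lbrakk>x \<in> carrier G; y \<in> carrier G; z \<in> carrier G\<rbrakk> \<Longrightarrow>
      x \<otimes> (y \<squnion>\<^bsub>lattice_of G\<^esub> z) = (x \<otimes> y) \<squnion>\<^bsub>lattice_of G\<^esub> (x \<otimes> z)"

locale unital_lgroup = lgroup +
  fixes u
  assumes unit_closed: "u \<in> carrier G"
    and order_unit: "g \<in> carrier G \<Longrightarrow> \<exists>n::nat. n \<ge> 1 \<and> leq G g (u [^] n)"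

definition unital_lhom :: "'a lgroup \<Rightarrow> 'a \<Rightarrow> 'b lgroup \<Rightarrow> 'b \<Rightarrow> ('a \<Rightarrow> 'b) set" where
  "unital_lhom G u H v =
     {h \<in> hom G H. h u = v \<and>
        (\<forall>x \<in> carrier G. \<forall>y \<in> carrier G.
           h (x \<squnion>\<^bsub>lattice_of G\<^esub> y) = h x \<squnion>\<^bsub>lattice_of H\<^esub> h y \<and>
           h (x \<sqinter>\<^bsub>lattice_of G\<^esub> y) = h x \<sqinter>\<^bsub>lattice_of H\<^esub> h y)}"


section \<open>Ideals and the maximal spectrum\<close>

text \<open>
  The codomains of the homomorphisms are taken with carrier in the type of sets over the type
  of \<open>G\<close>. This is no restriction: a kernel depends only on the image, which can be copied to the
  set of fibres of the homomorphism; see \<open>kernel_lideal\<close> below.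
\<close>

definition lideal :: "'a lgroup \<Rightarrow> 'a \<Rightarrow> 'a set \<Rightarrow> bool" where
  "lideal G u I \<longleftrightarrow>
     (\<exists>(H :: 'a set lgroup) v h.
        unital_lgroup H v \<and> h \<in> unital_lhom G u H v \<and> I = kernel G H h)"

definition max_spec :: "'a lgroup \<Rightarrow> 'a \<Rightarrow> 'a set set" where
  "max_spec G u =
     {M. lideal G u M \<and> M \<noteq> carrier G \<and>
         (\<forall>I. lideal G u I \<and> I \<noteq> carrier G \<and> M \<subseteq> I \<longrightarrow> I = M)}"

definition max_spec_topology :: "'a lgroup \<Rightarrow> 'a \<Rightarrow> 'a set topology" where
  "max_spec_topology G u =
     topology_generated_by {max_spec G u - {p \<in> max_spec G u. a \<in> p} | a. a \<in> carrier G}"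


section \<open>Bases\<close>

definition lsubgroup :: "'a set \<Rightarrow> 'a lgroup \<Rightarrow> bool" where
  "lsubgroup H G \<longleftrightarrow> subgroup H G \<and>
     (\<forall>x \<in> H. \<forall>y \<in> H. x \<squnion>\<^bsub>lattice_of G\<^esub> y \<in> H \<and> x \<sqinter>\<^bsub>lattice_of G\<^esub> y \<in> H)"

text \<open>
  A relation rather than a function of \<open>b\<close>: for a basis \<open>B\<close> of \<open>(G,u)\<close> the values of \<open>m\<close> on \<open>B\<close>
  are unique.
\<close>

definition multiplicities :: "'a lgroup \<Rightarrow> 'a \<Rightarrow> 'a set \<Rightarrow> ('a \<Rightarrow> nat) \<Rightarrow> bool" where
  "multiplicities G u B m \<longleftrightarrow>
     (\<forall>b \<in> B. m b \<ge> 1) \<and> (\<Otimes>\<^bsub>G\<^esub>b \<in> B. b [^]\<^bsub>G\<^esub> m b) = u"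

definition basis :: "'a lgroup \<Rightarrow> 'a \<Rightarrow> 'a set \<Rightarrow> bool" where
  "basis G u B \<longleftrightarrow>
     finite B \<and>
     B \<subseteq> {g \<in> carrier G. leq G \<one>\<^bsub>G\<^esub> g \<and> g \<noteq> \<one>\<^bsub>G\<^esub>} \<and>
     (\<lambda>H. lsubgroup H G) hull B = carrier G \<and>
     (\<forall>k C. k \<ge> 1 \<and> C \<subseteq> B \<and> card C = k \<and> \<Sqinter>\<^bsub>lattice_of G\<^esub> C \<noteq> \<one>\<^bsub>G\<^esub> \<longrightarrow>
        subtopology (max_spec_topology G u) {M \<in> max_spec G u. B - C \<subseteq> M}
          homeomorphic_space
        subtopology (powertop_real UNIV) (standard_simplex (k - 1))) \<and>
     (\<exists>m. multiplicities G u B m)"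


section \<open>Projectivity\<close>

text \<open>
  HOL cannot quantify over types inside a formula, so the two types over which the test objects
  \<open>(A,a)\<close> and \<open>(B,b)\<close> range are parameters. A theorem about \<open>projective TYPE('b) TYPE('c)\<close> with
  unconstrained type variables \<open>'b\<close> and \<open>'c\<close> covers all test objects.
\<close>

definition projective :: "'b itself \<Rightarrow> 'c itself \<Rightarrow> 'a lgroup \<Rightarrow> 'a \<Rightarrow> bool" where
  "projective _ _ G u \<longleftrightarrow>
     (\<forall>(A :: 'b lgroup) a (B :: 'c lgroup) b \<psi> \<phi>.
        unital_lgroup A a \<and> unital_lgroup B b \<and>
        \<psi> \<in> unital_lhom A a B b \<and> \<psi> ` carrier A = carrier B \<and>
        \<phi> \<in> unital_lhom G u B b \<longrightarrow>
        (\<exists>\<theta> \<in> unital_lhom G u A a. \<forall>x \<in> carrier G. \<phi> x = \<psi> (\<theta> x)))"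


section \<open>Kernels into arbitrary types are ideals\<close>

lemma lattice_of_simps [simp]:
  "carrier (lattice_of G) = carrier G" "le (lattice_of G) = leq G" "eq (lattice_of G) = (=)"
  by (simp_all add: lattice_of_def)

lemma least_Upper_iff:
  assumes "x \<in> carrier G" "y \<in> carrier G"
  shows "least (lattice_of G) s (Upper (lattice_of G) {x, y}) \<longleftrightarrow>
    s \<in> carrier G \<and> leq G x s \<and> leq G y s \<and>
    (\<forall>z \<in> carrier G. leq G x z \<and> leq G y z \<longrightarrow> leq G s z)"
  using assms by (auto simp: least_def Upper_def)

lemma greatest_Lower_iff:
  assumes "x \<in> carrier G" "y \<in> carrier G"
  shows "greatest (lattice_of G) s (Lower (lattice_of G) {x, y}) \<longleftrightarrow>
    s \<in> carrier G \<and> leq G s x \<and> leq G s y \<and>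
    (\<forall>z \<in> carrier G. leq G z x \<and> leq G z y \<longrightarrow> leq G z s)"
  using assms by (auto simp: greatest_def Lower_def)

lemma join_eqI:
  assumes "partial_order (lattice_of G)" "x \<in> carrier G" "y \<in> carrier G"
    "s \<in> carrier G" "leq G x s" "leq G y s"
    "\<And>z. z \<in> carrier G \<Longrightarrow> leq G x z \<Longrightarrow> leq G y z \<Longrightarrow> leq G s z"
  shows "x \<squnion>\<^bsub>lattice_of G\<^esub> y = s"
proof -
  have s: "least (lattice_of G) s (Upper (lattice_of G) {x, y})"
    using assms by (simp add: least_Upper_iff)
  show ?thesis unfolding join_def sup_def
    by (rule some_equality, rule s) (rule partial_order.least_unique[OF assms(1) _ s])
qed

lemma meet_eqI:
  assumes "partial_order (lattice_of G)" "x \<in> carrier G" "y \<in> carrier G"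
    "s \<in> carrier G" "leq G s x" "leq G s y"
    "\<And>z. z \<in> carrier G \<Longrightarrow> leq G z x \<Longrightarrow> leq G z y \<Longrightarrow> leq G z s"
  shows "x \<sqinter>\<^bsub>lattice_of G\<^esub> y = s"
proof -
  have s: "greatest (lattice_of G) s (Lower (lattice_of G) {x, y})"
    using assms by (simp add: greatest_Lower_iff)
  show ?thesis unfolding meet_def inf_def
    by (rule some_equality, rule s) (rule partial_order.greatest_unique[OF assms(1) _ s])
qed

theorem kernel_lideal:
  fixes G :: "'a lgroup" and H :: "'b lgroup"
  assumes "unital_lgroup G u" and "unital_lgroup H v" and h: "h \<in> unital_lhom G u H v"
  shows "lideal G u (kernel G H h)"
proof -
  interpret G: unital_lgroup G u by fact
  interpret H: unital_lgroup H v by fact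
  interpret hom: group_hom G H h
    using h by unfold_locales (simp add: unital_lhom_def)
  note [simp] = H.order.join_closed[simplified] H.order.meet_closed[simplified]
    G.order.join_closed[simplified] G.order.meet_closed[simplified]
  have hu: "h u = v"
    and hj: "\<And>x y. x \<in> carrier G \<Longrightarrow> y \<in> carrier G \<Longrightarrow>
      h (x \<squnion>\<^bsub>lattice_of G\<^esub> y) = h x \<squnion>\<^bsub>lattice_of H\<^esub> h y"
    and hm: "\<And>x y. x \<in> carrier G \<Longrightarrow> y \<in> carrier G \<Longrightarrow>
      h (x \<sqinter>\<^bsub>lattice_of G\<^esub> y) = h x \<sqinter>\<^bsub>lattice_of H\<^esub> h y"
    using h by (auto simp: unital_lhom_def)
  define f where "f = (\<lambda>x. {z \<in> carrier G. h z = h x})"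
  define r where "r = (\<lambda>X. h (SOME x. x \<in> X))"
  have rf: "r (f x) = h x" if "x \<in> carrier G" for x
  proof -
    have "x \<in> f x" using that by (simp add: f_def)
    then have "(SOME z. z \<in> f x) \<in> f x" by (rule someI)
    then show ?thesis by (simp add: r_def f_def)
  qed
  have f_eq: "f x = f y \<longleftrightarrow> h x = h y" if "x \<in> carrier G" "y \<in> carrier G" for x y
  proof
    assume "f x = f y"
    then have "r (f x) = r (f y)" by (rule arg_cong)
    then show "h x = h y" using that by (simp only: rf)
  qed (simp add: f_def)
  define K where "K = \<lparr>carrier = f ` carrier G,
    mult = (\<lambda>X Y. {z \<in> carrier G. h z = r X \<otimes>\<^bsub>H\<^esub> r Y}),
    one = f \<one>\<^bsub>G\<^esub>, leq = (\<lambda>X Y. leq H (r X) (r Y))\<rparr>"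
  have K [simp]: "carrier K = f ` carrier G" "\<one>\<^bsub>K\<^esub> = f \<one>\<^bsub>G\<^esub>"
    by (simp_all add: K_def)
  have mK [simp]: "f x \<otimes>\<^bsub>K\<^esub> f y = f (x \<otimes>\<^bsub>G\<^esub> y)" if "x \<in> carrier G" "y \<in> carrier G" for x y
    using that by (simp add: K_def rf) (simp add: f_def)
  have lK [simp]: "leq K (f x) (f y) \<longleftrightarrow> leq H (h x) (h y)"
    if "x \<in> carrier G" "y \<in> carrier G" for x y
    using that by (simp add: K_def rf)
  interpret K: comm_group K
  proof (rule comm_groupI; clarsimp)
    show "\<exists>y\<in>carrier G. f (y \<otimes>\<^bsub>G\<^esub> x) = f \<one>\<^bsub>G\<^esub>" if "x \<in> carrier G" for x
      using that by (intro bexI[of _ "inv\<^bsub>G\<^esub> x"]) auto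
  qed (simp_all add: G.m_ac)
  have leH_trans: "leq H x z" if "leq H x y" "leq H y z"
    "x \<in> carrier H" "y \<in> carrier H" "z \<in> carrier H" for x y z
    using H.order.le_trans that by simp
  have po: "partial_order (lattice_of K)"
  proof (unfold_locales; clarsimp simp: f_eq)
    show "leq H (h x) (h x)" if "x \<in> carrier G" for x
      using H.order.le_refl that by simp
    show "h x = h y" if "leq H (h x) (h y)" "leq H (h y) (h x)" "x \<in> carrier G" "y \<in> carrier G"
      for x y using H.order.le_antisym that by simp
    show "leq H (h x) (h z)" if "leq H (h x) (h y)" "leq H (h y) (h z)"
      "x \<in> carrier G" "y \<in> carrier G" "z \<in> carrier G" for x y z
      using that(3-5) by (intro leH_trans[OF that(1,2)]) simp_all
  qed
  have leG: "least (lattice_of K) (f (x \<squnion>\<^bsub>lattice_of G\<^esub> y)) (Upper (lattice_of K) {f x, f y})"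
    if "x \<in> carrier G" "y \<in> carrier G" for x y
    using that H.order.join_left[simplified] H.order.join_right[simplified]
      H.order.join_le[simplified]
    by (subst least_Upper_iff) (auto simp: hj)
  have grG: "greatest (lattice_of K) (f (x \<sqinter>\<^bsub>lattice_of G\<^esub> y)) (Lower (lattice_of K) {f x, f y})"
    if "x \<in> carrier G" "y \<in> carrier G" for x y
    using that H.order.meet_left[simplified] H.order.meet_right[simplified]
      H.order.meet_le[simplified]
    by (subst greatest_Lower_iff) (auto simp: hm)
  interpret KL: lattice "lattice_of K"
  proof -
    interpret partial_order "lattice_of K" by (fact po)
    show "lattice (lattice_of K)"
      by (unfold_locales; clarsimp) (rule exI, rule leG grG, assumption+)+
  qed
  have jK: "f x \<squnion>\<^bsub>lattice_of K\<^esub> f y = f (x \<squnion>\<^bsub>lattice_of G\<^esub> y)"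
    if "x \<in> carrier G" "y \<in> carrier G" for x y
    using leG[OF that] that po by (intro join_eqI) (auto simp: least_Upper_iff)
  have meK: "f x \<sqinter>\<^bsub>lattice_of K\<^esub> f y = f (x \<sqinter>\<^bsub>lattice_of G\<^esub> y)"
    if "x \<in> carrier G" "y \<in> carrier G" for x y
    using grG[OF that] that po by (intro meet_eqI) (auto simp: greatest_Lower_iff)
  have pK: "f x [^]\<^bsub>K\<^esub> n = f (x [^]\<^bsub>G\<^esub> n)" if "x \<in> carrier G" for x and n :: nat
    using that by (induction n) auto
  have "unital_lgroup K (f u)"
  proof (unfold_locales; clarsimp simp: jK)
    show "f (x \<otimes>\<^bsub>G\<^esub> (y \<squnion>\<^bsub>lattice_of G\<^esub> z)) =
        f ((x \<otimes>\<^bsub>G\<^esub> y) \<squnion>\<^bsub>lattice_of G\<^esub> (x \<otimes>\<^bsub>G\<^esub> z))"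
      if "x \<in> carrier G" "y \<in> carrier G" "z \<in> carrier G" for x y z
      using G.mult_join_distrib that by simp
    show "f u \<in> f ` carrier G" using G.unit_closed by simp
    show "\<exists>n\<ge>Suc 0. leq K (f g) (f u [^]\<^bsub>K\<^esub> n)" if "g \<in> carrier G" for g
      using H.order_unit[of "h g"] that G.unit_closed
      by (auto simp: pK hom.hom_nat_pow hu)
  qed
  moreover have "f \<in> unital_lhom G u K (f u)"
    by (auto simp: unital_lhom_def hom_def jK meK)
  moreover have "kernel G H h = kernel G K f"
    by (simp add: kernel_def f_eq cong: conj_cong)
  ultimately show ?thesis
    unfolding lideal_def by blast
qed

end

theory Submission
  imports Defs
begin

text \<open>
  The point is that, under the hypotheses, \<open>G\<close> is the free object on its basis: for every \<open>\<ell>\<close>-group \<open>A\<close>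
  and every choice of elements \<open>x b \<ge> 0\<close> of \<open>A\<close> there is an \<open>\<ell>\<close>-homomorphism \<open>G \<rightarrow> A\<close> with \<open>b \<mapsto> x b\<close>
  (\<open>basis_extension\<close>). It sends \<open>u = \<Sum> m b \<cdot> b\<close> to \<open>\<Sum> m b \<cdot> x b\<close>. To lift a morphism \<open>\<phi>\<close> along a
  surjection \<open>\<psi>\<close> onto the codomain of \<open>\<phi>\<close> it is therefore enough to lift the elements \<open>\<phi> b\<close> to positive
  elements \<open>x b\<close> of \<open>(A,a)\<close> with \<open>\<Sum> m b \<cdot> x b = a\<close>. All of them except one are lifted in turn while keeping
  the partial sums below \<open>a\<close> (\<open>lift_bounded\<close>, \<open>lift_family\<close>); the last one, of multiplicity \<open>1\<close>, is
  then forced to be \<open>a\<close> minus the sum of the others, with no division necessary. In the comments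
  \<open>\<ell>\<close>-groups are written additively.

  Freeness means that an \<open>\<ell>\<close>-group term that vanishes at \<open>B\<close> vanishes at all positive families in all
  \<open>\<ell>\<close>-groups. This splits into an algebraic and a topological half, which meet in the real numbers.

  Algebra: a term vanishing at all nonnegative real points vanishes at all positive families
  (\<open>leval_eq_one_if_real\<close>). A family where it does not vanish is seen by a total preorder compatible with the
  \<open>\<ell>\<close>-group operations (\<open>total_lcone_avoiding\<close>). For this preorder every term agrees with an integer linear
  form as long as finitely many other forms are nonnegative (\<open>leval_linear_form\<close>), and Fourier-Motzkin
  elimination (\<open>total_preorder_real_point\<close>) turns this finite pattern of signs into one at a real point.

  Topology: a term vanishing at \<open>B\<close> vanishes at all nonnegative real points. By homogeneity only points of the
  simplex \<open>\<Delta>\<close> given by \<open>\<Sum> m b \<cdot> r b = 1\<close> matter, and for these it suffices that \<open>r\<close> is the restriction to \<open>B\<close> of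
  a unital \<open>\<ell>\<close>-homomorphism \<open>G \<rightarrow> \<real>\<close> (\<open>basis_real_point\<close>). Each maximal ideal is the kernel of such a
  homomorphism (\<open>max_spec_real_kernel\<close>, a form of Hoelder's theorem), and its values on \<open>B\<close>
  embed the compact space \<open>MaxSpec(G)\<close> into \<open>\<Delta>\<close>. Since \<open>\<Sqinter>B \<noteq> 0\<close>, the basis axiom applies to every
  nonempty \<open>C \<subseteq> B\<close>: the part of \<open>MaxSpec(G)\<close> in each face of \<open>\<Delta>\<close> is homeomorphic to a simplex of the same
  dimension. By induction the image contains the boundary of a face, and if it missed an interior
  point, then projecting from that point would make a sphere a retract of a contractible space
  (\<open>weighted_simplex_subset_image\<close>).
\<close>

section \<open>Order and arithmetic in an \<open>\<ell>\<close>-group\<close>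

context lgroup
begin

abbreviation lle (infix "\<preceq>" 50) where "x \<preceq> y \<equiv> leq G x y"
abbreviation ljoin (infixl "\<curlyvee>" 65) where "x \<curlyvee> y \<equiv> x \<squnion>\<^bsub>lattice_of G\<^esub> y"
abbreviation lmeet (infixl "\<curlywedge>" 70) where "x \<curlywedge> y \<equiv> x \<sqinter>\<^bsub>lattice_of G\<^esub> y"

lemmas ljoin_closed [simp] = order.join_closed [simplified]
lemmas lmeet_closed [simp] = order.meet_closed [simplified]
lemmas le_refl [simp] = order.le_refl [simplified]
lemmas le_trans = order.le_trans [simplified]
lemmas le_antisym = order.le_antisym [simplified]
lemmas le_join1 [simp] = order.join_left [simplified]
lemmas le_join2 [simp] = order.join_right [simplified]
lemmas join_least = order.join_le [simplified]
lemmas meet_le1 [simp] = order.meet_left [simplified]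
lemmas meet_le2 [simp] = order.meet_right [simplified]
lemmas meet_greatest = order.meet_le [simplified]

lemma mult_inv_cancel [simp]:
  assumes "x \<in> carrier G" "y \<in> carrier G"
  shows "x \<otimes> (inv x \<otimes> y) = y" "inv x \<otimes> (x \<otimes> y) = y"
  using assms by (simp_all flip: m_assoc)

lemma le_mult_left:
  assumes "x \<preceq> y" "x \<in> carrier G" "y \<in> carrier G" "z \<in> carrier G"
  shows "z \<otimes> x \<preceq> z \<otimes> y"
proof -
  have "x \<curlyvee> y = y"
    using assms by (intro le_antisym join_least) auto
  then have "z \<otimes> y = (z \<otimes> x) \<curlyvee> (z \<otimes> y)"
    using mult_join_distrib[of z x y] assms by simp
  then show ?thesis using le_join1[of "z \<otimes> x" "z \<otimes> y"] assms by simp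
qed

lemma le_mult_left_iff [simp]:
  assumes "x \<in> carrier G" "y \<in> carrier G" "z \<in> carrier G"
  shows "z \<otimes> x \<preceq> z \<otimes> y \<longleftrightarrow> x \<preceq> y"
  using le_mult_left[of x y z] le_mult_left[of "z \<otimes> x" "z \<otimes> y" "inv z"] assms by auto

lemma le_mult_right_iff [simp]:
  assumes "x \<in> carrier G" "y \<in> carrier G" "z \<in> carrier G"
  shows "x \<otimes> z \<preceq> y \<otimes> z \<longleftrightarrow> x \<preceq> y"
  using le_mult_left_iff[OF assms] assms by (simp add: m_comm)

lemma le_mult_mono:
  assumes "x \<preceq> y" "x' \<preceq> y'" "x \<in> carrier G" "y \<in> carrier G" "x' \<in> carrier G" "y' \<in> carrier G"
  shows "x \<otimes> x' \<preceq> y \<otimes> y'"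
  by (rule le_trans[of _ "x \<otimes> y'"]) (use assms in auto)

lemma le_iff_one_le:
  assumes "x \<in> carrier G" "y \<in> carrier G"
  shows "x \<preceq> y \<longleftrightarrow> \<one> \<preceq> y \<otimes> inv x"
  using le_mult_right_iff[of x y "inv x"] assms by simp

lemma le_mult_inv_iff:
  assumes "x \<in> carrier G" "y \<in> carrier G" "z \<in> carrier G"
  shows "x \<preceq> y \<otimes> inv z \<longleftrightarrow> x \<otimes> z \<preceq> y"
  using le_mult_right_iff[of x "y \<otimes> inv z" z] assms by (simp add: m_assoc)

lemma mult_inv_le_iff:
  assumes "x \<in> carrier G" "y \<in> carrier G" "z \<in> carrier G"
  shows "x \<otimes> inv z \<preceq> y \<longleftrightarrow> x \<preceq> y \<otimes> z"
  using le_mult_right_iff[of "x \<otimes> inv z" y z] assms by (simp add: m_assoc)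

lemma inv_le_inv_iff [simp]:
  assumes "x \<in> carrier G" "y \<in> carrier G"
  shows "inv x \<preceq> inv y \<longleftrightarrow> y \<preceq> x"
  using mult_inv_le_iff[of \<one> "inv y" x] le_mult_inv_iff[of \<one> x y] assms by (simp add: m_comm)

lemma one_le_pow:
  assumes "\<one> \<preceq> x" "x \<in> carrier G"
  shows "\<one> \<preceq> x [^] (n::nat)"
  by (induction n) (use assms le_mult_mono[of \<one> _ \<one>] in auto)

lemma pow_le_one:
  assumes "x \<preceq> \<one>" "x \<in> carrier G"
  shows "x [^] (n::nat) \<preceq> \<one>"
  by (induction n) (use assms le_mult_mono[of _ \<one> _ \<one>] in auto)

section \<open>Total cones\<close>

text \<open>
  The cones of elements that are nonnegative for some coarser group preorder. Closure under binary meets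
  is what distinguishes the positive cones of \<open>\<ell>\<close>-group quotients of \<open>G\<close> from those of its quotients as a mere
  ordered group; a total such cone is the positive cone of a totally ordered quotient.
\<close>

definition lcone :: "'a set \<Rightarrow> bool" where
  "lcone P \<longleftrightarrow> P \<subseteq> carrier G \<and> (\<forall>x \<in> carrier G. \<one> \<preceq> x \<longrightarrow> x \<in> P) \<and>
     (\<forall>x \<in> P. \<forall>y \<in> P. x \<otimes> y \<in> P \<and> x \<curlywedge> y \<in> P)"

definition total_lcone :: "'a set \<Rightarrow> bool" where
  "total_lcone P \<longleftrightarrow> lcone P \<and> (\<forall>x \<in> carrier G. x \<in> P \<or> inv x \<in> P)"

lemma lcone_up:
  assumes "lcone P" "x \<in> P" "x \<preceq> y" "y \<in> carrier G"
  shows "y \<in> P"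
proof -
  have "x \<in> carrier G" using assms by (auto simp: lcone_def)
  then have "x \<otimes> (y \<otimes> inv x) \<in> P"
    using assms by (auto simp: lcone_def le_iff_one_le[of x y])
  moreover have "x \<otimes> (y \<otimes> inv x) = y"
    using \<open>x \<in> carrier G\<close> assms by (simp add: m_comm[of y])
  ultimately show ?thesis by simp
qed

lemma lcone_nonneg: "lcone {x \<in> carrier G. \<one> \<preceq> x}"
  using le_mult_mono[of \<one> _ \<one>] by (auto simp: lcone_def intro: meet_greatest)

text \<open>
  The smallest cone that contains \<open>P\<close> and an element \<open>x \<le> 0\<close>. Negativity of \<open>x\<close> is what gives closure under meets:
  a lower bound \<open>p + n x\<close> may be relaxed to \<open>p + (n + k) x\<close>, so two bounds can be given a common multiple of \<open>x\<close>.
\<close>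

lemma lcone_extend:
  assumes P: "lcone P" and x: "x \<in> carrier G" "x \<preceq> \<one>"
  shows "lcone {q \<in> carrier G. \<exists>p \<in> P. \<exists>n::nat. p \<otimes> x [^] n \<preceq> q}" (is "lcone ?Q")
    and "P \<subseteq> {q \<in> carrier G. \<exists>p \<in> P. \<exists>n::nat. p \<otimes> x [^] n \<preceq> q}"
    and "x \<in> {q \<in> carrier G. \<exists>p \<in> P. \<exists>n::nat. p \<otimes> x [^] n \<preceq> q}"
proof -
  have Pc: "P \<subseteq> carrier G" and one: "\<one> \<in> P" using P by (auto simp: lcone_def)
  show sub: "P \<subseteq> ?Q"
    using Pc by (auto intro!: bexI exI[of _ "0::nat"])
  show "x \<in> ?Q"
    using x one by (auto intro!: bexI[of _ \<one>] exI[of _ "1::nat"])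
  show "lcone ?Q"
    unfolding lcone_def
  proof (intro conjI ballI impI)
    fix y z assume "y \<in> ?Q" "z \<in> ?Q"
    then obtain p q k l where yz: "y \<in> carrier G" "z \<in> carrier G" and pq: "p \<in> P" "q \<in> P"
      and le: "p \<otimes> x [^] (k::nat) \<preceq> y" "q \<otimes> x [^] (l::nat) \<preceq> z" by blast
    have c: "p \<in> carrier G" "q \<in> carrier G" using pq Pc by auto
    have "(p \<otimes> q) \<otimes> x [^] (k + l) = (p \<otimes> x [^] k) \<otimes> (q \<otimes> x [^] l)"
      using c x by (simp add: m_ac flip: nat_pow_mult)
    also have "\<dots> \<preceq> y \<otimes> z" using le c x yz by (intro le_mult_mono) auto
    finally have "p \<otimes> q \<otimes> x [^] (k + l) \<preceq> y \<otimes> z" .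
    moreover have "p \<otimes> q \<in> P" using pq P by (simp add: lcone_def)
    ultimately show "y \<otimes> z \<in> ?Q" using yz by (intro CollectI conjI bexI exI) auto
    have e: "p \<curlywedge> q \<otimes> x [^] (k + l) = (p \<curlywedge> q \<otimes> x [^] l) \<otimes> x [^] k"
         "p \<curlywedge> q \<otimes> x [^] (k + l) = (p \<curlywedge> q \<otimes> x [^] k) \<otimes> x [^] l"
      using c x by (simp_all add: m_ac flip: nat_pow_mult)
    have m: "p \<curlywedge> q \<otimes> x [^] n \<preceq> p" "p \<curlywedge> q \<otimes> x [^] n \<preceq> q" for n :: nat
      using le_mult_mono[OF meet_le1[of p q] pow_le_one[OF x(2,1), of n]]
        le_mult_mono[OF meet_le2[of p q] pow_le_one[OF x(2,1), of n]] c x by auto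
    have "p \<curlywedge> q \<otimes> x [^] (k + l) \<preceq> y"
      unfolding e(1) by (rule le_trans[OF _ le(1)]) (use m c x yz in auto)
    moreover have "p \<curlywedge> q \<otimes> x [^] (k + l) \<preceq> z"
      unfolding e(2) by (rule le_trans[OF _ le(2)]) (use m c x yz in auto)
    ultimately have "p \<curlywedge> q \<otimes> x [^] (k + l) \<preceq> y \<curlywedge> z"
      using c x yz by (intro meet_greatest) auto
    moreover have "p \<curlywedge> q \<in> P" using pq P by (simp add: lcone_def)
    ultimately show "y \<curlywedge> z \<in> ?Q" using yz by (intro CollectI conjI bexI exI) auto
  next
    fix y assume "y \<in> carrier G" "\<one> \<preceq> y"
    then show "y \<in> ?Q" using sub P by (auto simp: lcone_def)
  qed auto
qed

text \<open>
  Stated through upper bounds, the hypothesis is \<open>x \<squnion> y = 0\<close>, and the conclusion is \<open>x \<squnion> n y = 0\<close>: if \<open>n y + y\<close>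
  lies below \<open>z\<close>, then both \<open>x\<close> and \<open>n y\<close> lie below \<open>z - y\<close>, so \<open>y \<le> z\<close> by induction,
  and \<open>x \<le> z\<close> by assumption.
\<close>

lemma orthogonal_pow:
  assumes c: "x \<in> carrier G" "y \<in> carrier G" and le: "x \<preceq> \<one>" "y \<preceq> \<one>"
    and orth: "\<And>z. z \<in> carrier G \<Longrightarrow> x \<preceq> z \<Longrightarrow> y \<preceq> z \<Longrightarrow> \<one> \<preceq> z"
    and z: "z \<in> carrier G" "x \<preceq> z" "y [^] (n::nat) \<preceq> z"
  shows "\<one> \<preceq> z"
  using z
proof (induction n arbitrary: z)
  case (Suc n)
  have "x \<preceq> z \<otimes> inv y"
    by (rule le_trans[OF Suc.prems(2)]) (use Suc.prems c le in \<open>auto simp: le_mult_inv_iff intro: le_trans[of "z \<otimes> y" "z \<otimes> \<one>"]\<close>,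
        use le_mult_left_iff[of y \<one> z] in auto)
  moreover have "y [^] n \<preceq> z \<otimes> inv y"
    using Suc.prems c by (simp add: le_mult_inv_iff)
  ultimately have "\<one> \<preceq> z \<otimes> inv y" using Suc c by auto
  then have "y \<preceq> z" using Suc.prems c by (simp add: le_mult_inv_iff)
  then show ?case using orth Suc.prems by blast
qed auto

text \<open>
  The negative parts of \<open>g\<close> and of \<open>- g\<close> are orthogonal because the second is the first translated by \<open>- g\<close>.
\<close>

lemma neg_parts_orthogonal:
  assumes g: "g \<in> carrier G" and z: "z \<in> carrier G" "g \<curlywedge> \<one> \<preceq> z" "inv g \<curlywedge> \<one> \<preceq> z"
  shows "\<one> \<preceq> z"
proof -
  let ?x = "g \<curlywedge> \<one>"
  have "?x \<otimes> inv g \<preceq> inv g \<curlywedge> \<one>"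
    using g by (intro meet_greatest) (auto simp: mult_inv_le_iff)
  then have "?x \<otimes> inv g \<preceq> z" by (rule le_trans[OF _ z(3)]) (use g z in auto)
  then have "?x \<preceq> z \<otimes> g" using g z by (simp add: mult_inv_le_iff)
  then have "?x \<preceq> g \<otimes> z" using g z by (simp add: m_comm)
  then have "?x \<otimes> inv z \<preceq> g" using g z by (simp add: mult_inv_le_iff)
  moreover have "?x \<otimes> inv z \<preceq> \<one>" using g z by (simp add: mult_inv_le_iff)
  ultimately have "?x \<otimes> inv z \<preceq> ?x \<otimes> \<one>" using g z by (simp add: meet_greatest)
  then have "inv z \<preceq> inv \<one>" using g z by (subst (asm) le_mult_left_iff) auto
  then show ?thesis using z by (subst (asm) inv_le_inv_iff) auto
qed

text \<open>
  Separation of an element from a cone by a total cone, in the manner of the prime ideal theorem. A maximal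
  cone \<open>P\<close> without \<open>w\<close> is total: if neither \<open>g\<close> nor \<open>- g\<close> were in \<open>P\<close>, then adding the negative part of either
  would put \<open>w\<close> into the enlarged cone, so \<open>w\<close> would lie above \<open>s + k (g \<sqinter> 0)\<close> and \<open>s + l (- g \<sqinter> 0)\<close> for one \<open>s \<in> P\<close>;
  these two negative parts are orthogonal, whence \<open>s \<le> w\<close> and \<open>w \<in> P\<close>.
\<close>

lemma total_lcone_avoiding:
  assumes P0: "lcone P0" and w: "w \<in> carrier G" "w \<notin> P0"
  obtains P where "total_lcone P" "P0 \<subseteq> P" "w \<notin> P"
proof -
  let ?\<A> = "{P. lcone P \<and> P0 \<subseteq> P \<and> w \<notin> P}"
  have "\<exists>P \<in> ?\<A>. \<forall>Q \<in> ?\<A>. P \<subseteq> Q \<longrightarrow> Q = P"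
  proof (rule subset_Zorn_nonempty)
    show "?\<A> \<noteq> {}" using assms by blast
    fix \<C> assume ne: "\<C> \<noteq> {}" and ch: "subset.chain ?\<A> \<C>"
    have mem: "\<And>C. C \<in> \<C> \<Longrightarrow> lcone C \<and> P0 \<subseteq> C \<and> w \<notin> C"
      using ch by (auto simp: subset.chain_def)
    have "lcone (\<Union>\<C>)"
      unfolding lcone_def
    proof (intro conjI ballI impI)
      show "\<Union>\<C> \<subseteq> carrier G" using mem unfolding lcone_def by blast
      show "x \<in> \<Union>\<C>" if "x \<in> carrier G" "\<one> \<preceq> x" for x
        using that mem ne by (auto simp: lcone_def)
      fix x y assume "x \<in> \<Union>\<C>" "y \<in> \<Union>\<C>"
      then obtain C D where "C \<in> \<C>" "x \<in> C" "D \<in> \<C>" "y \<in> D" by blast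
      moreover have "C \<subseteq> D \<or> D \<subseteq> C"
        using ch calculation unfolding subset_chain_def by blast
      ultimately obtain C where "C \<in> \<C>" "x \<in> C" "y \<in> C" by blast
      then show "x \<otimes> y \<in> \<Union>\<C>" "x \<curlywedge> y \<in> \<Union>\<C>"
        using mem unfolding lcone_def by blast+
    qed
    then show "\<Union>\<C> \<in> ?\<A>" using mem ne by blast
  qed
  then obtain P where PA: "P \<in> ?\<A>" and maxA: "\<forall>Q \<in> ?\<A>. P \<subseteq> Q \<longrightarrow> Q = P"
    by (elim bexE)
  then have P: "lcone P" "P0 \<subseteq> P" "w \<notin> P" by simp_all
  have max: "Q = P" if "lcone Q" "P \<subseteq> Q" "w \<notin> Q" for Q
    using maxA that P(2) by auto
  have reach: "\<exists>p \<in> P. \<exists>n::nat. p \<otimes> (g \<curlywedge> \<one>) [^] n \<preceq> w" if "g \<in> carrier G" "g \<notin> P" for g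
  proof (rule ccontr)
    let ?Q = "{q \<in> carrier G. \<exists>p \<in> P. \<exists>n::nat. p \<otimes> (g \<curlywedge> \<one>) [^] n \<preceq> q}"
    assume "\<not> ?thesis"
    then have "w \<notin> ?Q" by blast
    then have "?Q = P" using lcone_extend[OF P(1), of "g \<curlywedge> \<one>"] that by (intro max) auto
    then have "g \<curlywedge> \<one> \<in> P" using lcone_extend(3)[OF P(1), of "g \<curlywedge> \<one>"] that by auto
    then show False using lcone_up[OF P(1), of "g \<curlywedge> \<one>" g] that by auto
  qed
  have "g \<in> P \<or> inv g \<in> P" if g: "g \<in> carrier G" for g
  proof (rule ccontr)
    assume "\<not> ?thesis"
    then obtain p q k l where pq: "p \<in> P" "q \<in> P"
      and le: "p \<otimes> (g \<curlywedge> \<one>) [^] (k::nat) \<preceq> w" "q \<otimes> (inv g \<curlywedge> \<one>) [^] (l::nat) \<preceq> w"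
      using reach[of g] reach[of "inv g"] g by auto
    define s where "s = p \<curlywedge> q"
    have c: "p \<in> carrier G" "q \<in> carrier G" "s \<in> carrier G"
      and s: "s \<in> P" using pq P(1) by (auto simp: lcone_def s_def)
    let ?x = "g \<curlywedge> \<one>" and ?y = "inv g \<curlywedge> \<one>" and ?z = "w \<otimes> inv s"
    have "s \<otimes> ?x [^] k \<preceq> w"
      by (rule le_trans[OF _ le(1)]) (use c g w in \<open>auto simp: s_def\<close>)
    then have x: "?x [^] k \<preceq> ?z" using c g w by (simp add: le_mult_inv_iff m_comm)
    have "s \<otimes> ?y [^] l \<preceq> w"
      by (rule le_trans[OF _ le(2)]) (use c g w in \<open>auto simp: s_def\<close>)
    then have y: "?y [^] l \<preceq> ?z" using c g w by (simp add: le_mult_inv_iff m_comm)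
    have orth: "\<one> \<preceq> z" if "z \<in> carrier G" "?x \<preceq> z" "?y [^] l \<preceq> z" for z
      by (rule orthogonal_pow[of ?x ?y z l]) (use that g neg_parts_orthogonal[of g] in auto)
    have "\<one> \<preceq> ?z"
      by (rule orthogonal_pow[of "?y [^] l" ?x ?z k])
        (use x y g w c orth pow_le_one[of ?y l] in auto)
    then have "s \<preceq> w" using c w by (simp add: le_mult_inv_iff)
    then show False using lcone_up[OF P(1) s] w P(3) by blast
  qed
  then have "total_lcone P" using P(1) by (simp add: total_lcone_def)
  then show thesis using P(2,3) by (rule that)
qed

text \<open>
  If \<open>y \<le> x\<close> for the preorder of \<open>P\<close>, then \<open>x \<sqinter> y\<close> and \<open>x \<squnion> y\<close> are equivalent to \<open>y\<close> and \<open>x\<close>: both differences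
  dominate \<open>(x - y) \<sqinter> 0\<close>, which is in \<open>P\<close>.
\<close>

lemma lcone_meet_join:
  assumes "lcone P" "x \<in> carrier G" "y \<in> carrier G" "x \<otimes> inv y \<in> P"
  shows "(x \<curlywedge> y) \<otimes> inv y \<in> P" and "x \<otimes> inv (x \<curlyvee> y) \<in> P"
proof -
  let ?z = "(x \<otimes> inv y) \<curlywedge> \<one>"
  have z: "?z \<in> P" "?z \<in> carrier G" using assms by (auto simp: lcone_def)
  have le: "?z \<preceq> x \<otimes> inv y" "?z \<preceq> \<one>" using assms by auto
  have "?z \<otimes> y \<preceq> x" using le assms z by (simp add: le_mult_inv_iff)
  moreover have "?z \<otimes> y \<preceq> y" using le_mult_right_iff[of ?z \<one> y] le z assms by simp
  ultimately have "?z \<preceq> (x \<curlywedge> y) \<otimes> inv y"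
    using assms z by (simp add: le_mult_inv_iff meet_greatest)
  then show "(x \<curlywedge> y) \<otimes> inv y \<in> P" using lcone_up[OF assms(1) z(1)] assms by auto
  have "x \<preceq> inv ?z \<otimes> x" using le_mult_right_iff[of \<one> "inv ?z" x] inv_le_inv_iff[of \<one> ?z] le z assms by simp
  moreover have "y \<preceq> inv ?z \<otimes> x"
    using \<open>?z \<otimes> y \<preceq> x\<close> le_mult_left_iff[of "?z \<otimes> y" x "inv ?z"] z assms by simp
  ultimately have "x \<curlyvee> y \<preceq> inv ?z \<otimes> x" using assms z by (simp add: join_least)
  then have "?z \<otimes> (x \<curlyvee> y) \<preceq> ?z \<otimes> (inv ?z \<otimes> x)" using assms z by (subst le_mult_left_iff) auto
  then have "?z \<preceq> x \<otimes> inv (x \<curlyvee> y)" using assms z by (simp add: le_mult_inv_iff)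
  then show "x \<otimes> inv (x \<curlyvee> y) \<in> P" using lcone_up[OF assms(1) z(1)] assms by auto
qed

end

section \<open>Morphisms\<close>

lemma unital_lhom_group_hom:
  assumes "lgroup G" "lgroup H" "h \<in> unital_lhom G u H v"
  shows "group_hom G H h"
  using assms
  by (intro group_hom.intro group_hom_axioms.intro)
    (auto simp: unital_lhom_def lgroup_def comm_group_def)

lemma unital_lhom_lattice:
  assumes "h \<in> unital_lhom G u H v" "x \<in> carrier G" "y \<in> carrier G"
  shows "h (x \<squnion>\<^bsub>lattice_of G\<^esub> y) = h x \<squnion>\<^bsub>lattice_of H\<^esub> h y"
    and "h (x \<sqinter>\<^bsub>lattice_of G\<^esub> y) = h x \<sqinter>\<^bsub>lattice_of H\<^esub> h y"
  using assms by (auto simp: unital_lhom_def)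

lemma unital_lhom_mono:
  assumes G: "lgroup G" and H: "lgroup H" and h: "h \<in> unital_lhom G u H v"
    and xy: "x \<in> carrier G" "y \<in> carrier G" "leq G x y"
  shows "leq H (h x) (h y)"
proof -
  interpret G: lgroup G by fact
  interpret H: lgroup H by fact
  interpret group_hom G H h by (rule unital_lhom_group_hom[OF G H h])
  have "x \<squnion>\<^bsub>lattice_of G\<^esub> y = y" using xy by (intro G.le_antisym G.join_least) auto
  then have "h y = h x \<squnion>\<^bsub>lattice_of H\<^esub> h y" using unital_lhom_lattice(1)[OF h xy(1,2)] by simp
  then show ?thesis using H.le_join1[of "h x" "h y"] xy by simp
qed

lemma hom_finprod_pow:
  assumes G: "comm_group G" and H: "comm_group H" and h: "h \<in> hom G H"
    and B: "finite B" "\<And>b. b \<in> B \<Longrightarrow> x b \<in> carrier G"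
  shows "h (\<Otimes>\<^bsub>G\<^esub>b\<in>B. x b [^]\<^bsub>G\<^esub> (m b :: nat)) = (\<Otimes>\<^bsub>H\<^esub>b\<in>B. h (x b) [^]\<^bsub>H\<^esub> m b)"
proof -
  interpret G: comm_group G by fact
  interpret H: comm_group H by fact
  interpret h: group_hom G H h using h by unfold_locales
  show ?thesis
    using B
  proof (induction B rule: finite_induct)
    case (insert b B)
    then have "(\<lambda>b. x b [^]\<^bsub>G\<^esub> m b) \<in> B \<rightarrow> carrier G" "(\<lambda>b. h (x b) [^]\<^bsub>H\<^esub> m b) \<in> B \<rightarrow> carrier H"
      by (auto intro!: G.nat_pow_closed H.nat_pow_closed)
    then show ?case using insert by (simp add: h.hom_nat_pow)
  qed simp
qed

section \<open>Real characters and maximal ideals\<close>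

definition real_lgroup :: "real lgroup" where
  "real_lgroup = \<lparr>carrier = UNIV, mult = (+), one = 0, leq = (\<le>)\<rparr>"

lemma real_lgroup_simps [simp]:
  "carrier real_lgroup = UNIV" "x \<otimes>\<^bsub>real_lgroup\<^esub> y = x + y" "\<one>\<^bsub>real_lgroup\<^esub> = 0"
  "leq real_lgroup x y \<longleftrightarrow> x \<le> y"
  by (simp_all add: real_lgroup_def)

lemma partial_order_real_lgroup: "partial_order (lattice_of real_lgroup)"
  by unfold_locales auto

lemma real_lgroup_join [simp]: "x \<squnion>\<^bsub>lattice_of real_lgroup\<^esub> y = max x y"
  by (rule join_eqI[OF partial_order_real_lgroup]) auto

lemma real_lgroup_meet [simp]: "x \<sqinter>\<^bsub>lattice_of real_lgroup\<^esub> y = min x y"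
  by (rule meet_eqI[OF partial_order_real_lgroup]) auto

lemma comm_group_real_lgroup: "comm_group real_lgroup"
proof (rule comm_groupI)
  show "\<exists>y\<in>carrier real_lgroup. y \<otimes>\<^bsub>real_lgroup\<^esub> x = \<one>\<^bsub>real_lgroup\<^esub>" for x
    by (auto intro!: exI[of _ "- x"])
qed auto

lemma real_lgroup_inv [simp]: "inv\<^bsub>real_lgroup\<^esub> x = - x"
  using group.inv_equality[of real_lgroup "- x" x] comm_group_real_lgroup
  by (simp add: comm_group_def)

lemma real_lgroup_pow [simp]: "x [^]\<^bsub>real_lgroup\<^esub> (n::nat) = real n * x"
  by (induction n) (auto simp: nat_pow_def algebra_simps)

lemma real_lgroup_int_pow [simp]: "x [^]\<^bsub>real_lgroup\<^esub> (k::int) = of_int k * x"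
  by (simp add: int_pow_def2)

lemma finprod_real_lgroup: "finite B \<Longrightarrow> (\<Otimes>\<^bsub>real_lgroup\<^esub>b\<in>B. f b) = (\<Sum>b\<in>B. f b)"
proof (induction B rule: finite_induct)
  interpret comm_group real_lgroup by (rule comm_group_real_lgroup)
  case (insert b B) then show ?case by simp
qed (simp add: finprod_def)

lemma unital_real_lgroup: "unital_lgroup real_lgroup 1"
proof -
  interpret comm_group real_lgroup by (rule comm_group_real_lgroup)
  interpret partial_order "lattice_of real_lgroup" by (rule partial_order_real_lgroup)
  show ?thesis
  proof unfold_locales
    show "\<exists>s. least (lattice_of real_lgroup) s (Upper (lattice_of real_lgroup) {x, y})"
      if "x \<in> carrier (lattice_of real_lgroup)" "y \<in> carrier (lattice_of real_lgroup)" for x y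
      by (rule exI[of _ "max x y"]) (simp add: least_Upper_iff)
    show "\<exists>s. greatest (lattice_of real_lgroup) s (Lower (lattice_of real_lgroup) {x, y})"
      if "x \<in> carrier (lattice_of real_lgroup)" "y \<in> carrier (lattice_of real_lgroup)" for x y
      by (rule exI[of _ "min x y"]) (simp add: greatest_Lower_iff)
    fix g :: real
    obtain n :: nat where "g \<le> real n" using real_arch_simple by blast
    then show "\<exists>n::nat. 1 \<le> n \<and> leq real_lgroup g (1 [^]\<^bsub>real_lgroup\<^esub> n)"
      by (intro exI[of _ "Suc n"]) auto
  qed auto
qed

context unital_lgroup
begin

text \<open>
  The rational lower bounds \<open>p/q\<close> of \<open>x\<close> measured in the unit, in the sense that \<open>p u \<le> q x\<close> for the preorder of \<open>P\<close>.
\<close>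

definition slopes :: "'a set \<Rightarrow> 'a \<Rightarrow> real set" where
  "slopes P x = {of_int p / of_int q | p q::int. 0 < q \<and> x [^] q \<otimes> inv (u [^] p) \<in> P}"

lemma lcone_int_pow:
  assumes "lcone P" "x \<in> P" "0 \<le> (k::int)"
  shows "x [^] k \<in> P"
proof -
  have "x [^] n \<in> P" for n :: nat
    by (induction n) (use assms in \<open>auto simp: lcone_def\<close>)
  then show ?thesis using assms(3) by (metis int_pow_int nonneg_int_cases)
qed

lemma slopes_add:
  assumes P: "lcone P" and c: "x \<in> carrier G" "y \<in> carrier G"
    and a: "a \<in> slopes P x" and b: "b \<in> slopes P y"
  shows "a + b \<in> slopes P (x \<otimes> y)"
proof -
  obtain p q p' q' :: int where a: "a = of_int p / of_int q" "0 < q" "x [^] q \<otimes> inv (u [^] p) \<in> P"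
    and b: "b = of_int p' / of_int q'" "0 < q'" "y [^] q' \<otimes> inv (u [^] p') \<in> P"
    using a b unfolding slopes_def by blast
  note [simp] = c unit_closed
  have "(x [^] q \<otimes> inv (u [^] p)) [^] q' \<otimes> (y [^] q' \<otimes> inv (u [^] p')) [^] q \<in> P"
    using lcone_int_pow[OF P a(3), of q'] lcone_int_pow[OF P b(3), of q] a(2) b(2) P
    by (auto simp: lcone_def)
  also have "(x [^] q \<otimes> inv (u [^] p)) [^] q' \<otimes> (y [^] q' \<otimes> inv (u [^] p')) [^] q =
      (x \<otimes> y) [^] (q * q') \<otimes> inv (u [^] (q' * p + q * p'))"
    by (simp add: int_pow_distrib int_pow_pow int_pow_inv int_pow_mult inv_mult mult.commute m_ac)
  finally have "of_int (q' * p + q * p') / of_int (q * q') \<in> slopes P (x \<otimes> y)"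
    using a(2) b(2) unfolding slopes_def by (intro CollectI exI conjI refl) auto
  moreover have "of_int (q' * p + q * p') / of_int (q * q') = a + b"
    using a b by (simp add: field_simps)
  ultimately show ?thesis by simp
qed

lemma slopes_one_le:
  assumes P: "total_lcone P" "inv u \<notin> P" and a: "a \<in> slopes P \<one>"
  shows "a \<le> 0"
proof (rule ccontr)
  assume "\<not> ?thesis"
  then obtain p q :: int where pq: "a = of_int p / of_int q" "0 < q" "\<one> [^] q \<otimes> inv (u [^] p) \<in> P"
    and "0 < a" using a unfolding slopes_def by auto
  then have "0 < p" by (simp add: zero_less_divide_iff)
  have lP: "lcone P" and "u \<in> P"
    using P unit_closed unfolding total_lcone_def by auto
  then have "u [^] (p - 1) \<otimes> inv (u [^] p) \<in> P"
    using pq(3) lcone_int_pow[OF lP \<open>u \<in> P\<close>, of "p - 1"] \<open>0 < p\<close> unit_closed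
    by (auto simp: lcone_def)
  also have "u [^] (p - 1) \<otimes> inv (u [^] p) = u [^] (p - 1 + - p)"
    using unit_closed by (simp only: int_pow_mult int_pow_neg)
  also have "\<dots> = inv u" using unit_closed int_pow_neg[of u 1] by simp
  finally show False using P(2) by simp
qed

lemma slopes_nonneg:
  assumes "x \<in> P" "x \<in> carrier G"
  shows "0 \<in> slopes P x"
  unfolding slopes_def
  by (intro CollectI exI[of _ "0::int"] exI[of _ "1::int"]) (use assms in auto)

lemma slopes_bounded:
  assumes P: "total_lcone P" "inv u \<notin> P" and x: "x \<in> carrier G"
  shows "slopes P x \<noteq> {}" "bdd_above (slopes P x)"
proof -
  have lP: "lcone P" using P by (simp add: total_lcone_def)
  have ex: "\<exists>n::nat. - real n \<in> slopes P y" if y: "y \<in> carrier G" for y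
  proof -
    obtain n :: nat where "inv y \<preceq> u [^] n" using order_unit[of "inv y"] y by auto
    then have "inv (u [^] n) \<preceq> y" using y unit_closed inv_le_inv_iff[of "u [^] n" "inv y"] by simp
    then have "\<one> \<preceq> y \<otimes> u [^] n" using y unit_closed mult_inv_le_iff[of \<one> y "u [^] n"] by simp
    then have "y [^] (1::int) \<otimes> inv (u [^] (- int n)) \<in> P"
      using lP y unit_closed by (simp add: lcone_def int_pow_neg int_pow_int)
    then have "of_int (- int n) / of_int 1 \<in> slopes P y"
      unfolding slopes_def by (intro CollectI exI conjI refl) auto
    then show ?thesis by auto
  qed
  show "slopes P x \<noteq> {}" using ex[OF x] by auto
  obtain n :: nat where n: "- real n \<in> slopes P (inv x)" using ex[of "inv x"] x by auto
  have "a \<le> real n" if "a \<in> slopes P x" for a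
    using slopes_one_le[OF P] slopes_add[OF lP _ _ that n] x by fastforce
  then show "bdd_above (slopes P x)" by (auto simp: bdd_above_def)
qed

text \<open>
  The argument of Hoelder's theorem: the supremum of the slopes of \<open>x\<close> is a real number because \<open>u\<close> is an
  order-unit. It is superadditive by construction. A rational above the supremum is not a slope of \<open>x\<close>, so totality makes its
  negative a slope of \<open>- x\<close>; this gives oddness, hence additivity. Lattice operations are preserved since any two
  elements are comparable for \<open>P\<close>.
\<close>

theorem real_hom_of_total_lcone:
  assumes P: "total_lcone P" "inv u \<notin> P"
  obtains r where "r \<in> unital_lhom G u real_lgroup 1" "\<And>x. x \<in> P \<Longrightarrow> 0 \<le> r x"
proof -
  have lP: "lcone P" using P by (simp add: total_lcone_def)
  have Pc: "P \<subseteq> carrier G" using lP by (simp add: lcone_def)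
  define r where "r x = Sup (slopes P x)" for x
  note bd = slopes_bounded[OF P]
  have upper: "a \<le> r x" if "a \<in> slopes P x" "x \<in> carrier G" for a x
    unfolding r_def using that bd by (intro cSup_upper) auto
  have super: "r x + r y \<le> r (x \<otimes> y)" if c: "x \<in> carrier G" "y \<in> carrier G" for x y
  proof -
    have "r x \<le> r (x \<otimes> y) - b" if b: "b \<in> slopes P y" for b
      unfolding r_def[of x]
    proof (rule cSup_least)
      fix a assume "a \<in> slopes P x"
      then have "a + b \<le> r (x \<otimes> y)" using slopes_add[OF lP c] b c by (intro upper) auto
      then show "a \<le> r (x \<otimes> y) - b" by simp
    qed (use bd c in auto)
    then have "b \<le> r (x \<otimes> y) - r x" if "b \<in> slopes P y" for b
      using that by force
    then have "r y \<le> r (x \<otimes> y) - r x"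
      unfolding r_def[of y] using bd c by (intro cSup_least) auto
    then show ?thesis by simp
  qed
  have r_one: "r \<one> = 0"
  proof (rule antisym)
    show "r \<one> \<le> 0" unfolding r_def using slopes_one_le[OF P] bd by (intro cSup_least) auto
    show "0 \<le> r \<one>" using lP by (intro upper slopes_nonneg) (auto simp: lcone_def)
  qed
  have r_inv: "r (inv x) = - r x" if x: "x \<in> carrier G" for x
  proof (rule antisym)
    show "r (inv x) \<le> - r x" using super[of x "inv x"] r_one x by simp
    show "- r x \<le> r (inv x)"
    proof (rule ccontr)
      assume "\<not> ?thesis"
      then obtain c where "c \<in> \<rat>" "r x < c" "c < - r (inv x)"
        using Rats_dense_in_real[of "r x" "- r (inv x)"] by auto
      then obtain p q :: int where c: "c = of_int p / of_int q" "0 < q"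
        by (elim Rats_cases')
      have "x [^] q \<otimes> inv (u [^] p) \<notin> P"
      proof
        assume "x [^] q \<otimes> inv (u [^] p) \<in> P"
        then have "c \<in> slopes P x" unfolding slopes_def using c by blast
        then show False using upper x \<open>r x < c\<close> by force
      qed
      then have "inv (x [^] q \<otimes> inv (u [^] p)) \<in> P"
        using P(1) x unit_closed by (auto simp: total_lcone_def)
      then have "(inv x) [^] q \<otimes> inv (u [^] (- p)) \<in> P"
        using x unit_closed by (simp add: inv_mult int_pow_inv int_pow_neg)
      then have "of_int (- p) / of_int q \<in> slopes P (inv x)"
        unfolding slopes_def using c by blast
      then have "- c \<le> r (inv x)" using upper[of _ "inv x"] x c by simp
      then show False using \<open>c < - r (inv x)\<close> by simp
    qed
  qed
  have r_mult: "r (x \<otimes> y) = r x + r y" if c: "x \<in> carrier G" "y \<in> carrier G" for x y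
  proof (rule antisym)
    have "- r x + - r y \<le> - r (x \<otimes> y)"
      using super[of "inv x" "inv y"] c by (simp add: r_inv inv_mult flip: inv_mult)
    then show "r (x \<otimes> y) \<le> r x + r y" by simp
  qed (rule super[OF c])
  have r_nonneg: "0 \<le> r x" if "x \<in> P" for x
    using that Pc by (intro upper slopes_nonneg) auto
  have r_mono: "r y \<le> r x" if "x \<in> carrier G" "y \<in> carrier G" "x \<otimes> inv y \<in> P" for x y
    using r_nonneg[OF that(3)] that by (simp add: r_mult r_inv)
  have r_mono': "r y \<le> r x" if "x \<in> carrier G" "y \<in> carrier G" "y \<preceq> x" for x y
    using that lP le_iff_one_le[of y x] by (intro r_mono) (simp_all add: lcone_def)
  have r_lat: "r (x \<curlywedge> y) = r y \<and> r (x \<curlyvee> y) = r x"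
    if "x \<in> carrier G" "y \<in> carrier G" "x \<otimes> inv y \<in> P" for x y
    using lcone_meet_join[OF lP that] that
    by (intro conjI antisym) (auto intro: r_mono r_mono')
  have "r u = 1"
  proof (rule antisym)
    have "1 \<in> slopes P u"
      unfolding slopes_def
      by (intro CollectI exI[of _ "1::int"]) (use unit_closed lP in \<open>auto simp: lcone_def\<close>)
    then show "1 \<le> r u" using upper unit_closed by blast
    have "-1 \<in> slopes P (inv u)"
      unfolding slopes_def
      by (intro CollectI exI[of _ "- 1::int"] exI[of _ "1::int"])
        (use unit_closed lP in \<open>auto simp: lcone_def int_pow_neg\<close>)
    then have "-1 \<le> r (inv u)" using upper unit_closed by blast
    then show "r u \<le> 1" using unit_closed by (simp add: r_inv)
  qed
  moreover have "r (x \<curlyvee> y) = max (r x) (r y) \<and> r (x \<curlywedge> y) = min (r x) (r y)"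
    if c: "x \<in> carrier G" "y \<in> carrier G" for x y
  proof -
    consider "x \<otimes> inv y \<in> P" | "y \<otimes> inv x \<in> P"
      using P(1) c unfolding total_lcone_def by (metis inv_closed inv_inv inv_mult m_closed m_comm)
    then show ?thesis
    proof cases
      case 1
      then show ?thesis using r_lat[OF c 1] r_mono[OF c 1] by (simp add: max_def min_def)
    next
      case 2
      then show ?thesis
        using r_lat[OF c(2,1) 2] r_mono[OF c(2,1) 2]
        by (simp add: join_comm[of _ x y] meet_comm[of _ x y] max_def min_def)
    qed
  qed
  ultimately have "r \<in> unital_lhom G u real_lgroup 1"
    by (auto simp: unital_lhom_def hom_def r_mult)
  then show thesis using r_nonneg by (rule that)
qed

end

text \<open>
  A proper ideal \<open>M\<close> determines the cone of elements that are nonnegative modulo \<open>M\<close>, which misses \<open>- u\<close>. A total cone above it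
  that still misses \<open>- u\<close> yields a real character vanishing on \<open>M\<close>; its kernel is a proper ideal, so it is \<open>M\<close> itself when \<open>M\<close>
  is maximal, without any analysis of the quotient by \<open>M\<close>.
\<close>

theorem (in unital_lgroup) max_spec_real_kernel:
  assumes M: "M \<in> max_spec G u"
  obtains r where "r \<in> unital_lhom G u real_lgroup 1" "M = kernel G real_lgroup r"
proof -
  have unital: "unital_lgroup G u" by unfold_locales
  have "lideal G u M" and proper: "M \<noteq> carrier G"
    and max: "\<And>I. lideal G u I \<Longrightarrow> I \<noteq> carrier G \<Longrightarrow> M \<subseteq> I \<Longrightarrow> I = M"
    using M by (simp_all add: max_spec_def)
  then obtain H :: "'a set lgroup" and v h where H: "unital_lgroup H v"
    and h: "h \<in> unital_lhom G u H v" and Mh: "M = kernel G H h"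
    unfolding lideal_def by blast
  interpret H: unital_lgroup H v by fact
  interpret hom: group_hom G H h
    using h by unfold_locales (simp add: unital_lhom_def)
  have hu: "h u = v"
    and hm: "\<And>x y. x \<in> carrier G \<Longrightarrow> y \<in> carrier G \<Longrightarrow>
      h (x \<curlywedge> y) = h x \<sqinter>\<^bsub>lattice_of H\<^esub> h y"
    and hj: "\<And>x y. x \<in> carrier G \<Longrightarrow> y \<in> carrier G \<Longrightarrow>
      h (x \<curlyvee> y) = h x \<squnion>\<^bsub>lattice_of H\<^esub> h y"
    using h by (auto simp: unital_lhom_def)
  define P0 where "P0 = {x \<in> carrier G. leq H \<one>\<^bsub>H\<^esub> (h x)}"
  have pos: "x \<in> P0" if x: "x \<in> carrier G" "\<one> \<preceq> x" for x
  proof -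
    have "\<one> \<curlyvee> x = x" using x by (intro le_antisym join_least) auto
    then have "\<one>\<^bsub>H\<^esub> \<squnion>\<^bsub>lattice_of H\<^esub> h x = h x" using hj[of \<one> x] x by simp
    then show ?thesis using x H.le_join1[of "\<one>\<^bsub>H\<^esub>" "h x"] by (simp add: P0_def)
  qed
  have P0: "lcone P0"
    unfolding lcone_def using pos H.le_mult_mono[of "\<one>\<^bsub>H\<^esub>" _ "\<one>\<^bsub>H\<^esub>"] hm H.meet_greatest[of "\<one>\<^bsub>H\<^esub>"]
    by (auto simp: P0_def)
  have "inv u \<notin> P0"
  proof
    assume "inv u \<in> P0"
    then have "leq H \<one>\<^bsub>H\<^esub> (inv\<^bsub>H\<^esub> v)" using unit_closed hu by (simp add: P0_def)
    then have v: "leq H v \<one>\<^bsub>H\<^esub>"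
      using H.inv_le_inv_iff[of "inv\<^bsub>H\<^esub> \<one>\<^bsub>H\<^esub>" v] H.unit_closed by simp
    have le: "leq H y \<one>\<^bsub>H\<^esub>" if y: "y \<in> carrier H" for y
    proof -
      obtain n :: nat where "leq H y (v [^]\<^bsub>H\<^esub> n)" using H.order_unit[OF y] by blast
      then show ?thesis
        by (rule H.le_trans[OF _ H.pow_le_one[OF v H.unit_closed]]) (use y H.unit_closed in auto)
    qed
    have "y = \<one>\<^bsub>H\<^esub>" if y: "y \<in> carrier H" for y
      using le[OF y] le[of "inv\<^bsub>H\<^esub> y"] H.inv_le_inv_iff[of y "\<one>\<^bsub>H\<^esub>"] y
      by (intro H.le_antisym) auto
    then have "h x = \<one>\<^bsub>H\<^esub>" if "x \<in> carrier G" for x using that by simp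
    then show False using proper unfolding Mh kernel_def by blast
  qed
  then obtain P where P: "total_lcone P" "P0 \<subseteq> P" "inv u \<notin> P"
    using total_lcone_avoiding[OF P0, of "inv u"] unit_closed by auto
  obtain r where r: "r \<in> unital_lhom G u real_lgroup 1" and r0: "\<And>x. x \<in> P \<Longrightarrow> 0 \<le> r x"
    using real_hom_of_total_lcone[OF P(1,3)] by blast
  interpret rh: group_hom G real_lgroup r
    using r comm_group_real_lgroup
    by (intro group_hom.intro group_hom_axioms.intro) (auto simp: unital_lhom_def comm_group_def)
  let ?K = "kernel G real_lgroup r"
  have "lideal G u ?K" by (rule kernel_lideal[OF unital unital_real_lgroup r])
  moreover have "u \<notin> ?K" using r by (simp add: kernel_def unital_lhom_def)
  then have "?K \<noteq> carrier G" using unit_closed by blast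
  moreover have "M \<subseteq> ?K"
  proof
    fix x assume "x \<in> M"
    then have x: "x \<in> carrier G" "x \<in> P0" "inv x \<in> P0"
      by (auto simp: Mh kernel_def P0_def)
    then have "0 \<le> r x" "0 \<le> r (inv x)" using r0 P(2) by blast+
    then show "x \<in> ?K" using x(1) rh.hom_inv[of x] by (simp add: kernel_def)
  qed
  ultimately have "?K = M" by (rule max)
  then show thesis using r that by blast
qed

section \<open>Real points for a total preorder on integer forms\<close>

text \<open>
  Finitely many lower and upper bounds, those indexed by \<open>S\<close> being strict. The midpoint of the largest lower and the smallest upper
  bound satisfies all of them at once, also when these two bounds coincide: then neither of them is strict.
\<close>

lemma exists_between_bounds:
  fixes lo hi :: "'i \<Rightarrow> real"
  assumes fin: "finite A" "finite B"
    and le: "\<And>i j. i \<in> A \<Longrightarrow> j \<in> B \<Longrightarrow> lo i \<le> hi j"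
    and less: "\<And>i j. i \<in> A \<Longrightarrow> j \<in> B \<Longrightarrow> i \<in> S \<or> j \<in> S \<Longrightarrow> lo i < hi j"
  shows "\<exists>c. (\<forall>i \<in> A. lo i \<le> c \<and> (i \<in> S \<longrightarrow> lo i < c)) \<and>
    (\<forall>j \<in> B. c \<le> hi j \<and> (j \<in> S \<longrightarrow> c < hi j))"
proof -
  consider "A = {}" | "B = {}" | "A \<noteq> {}" "B \<noteq> {}" by blast
  then show ?thesis
  proof cases
    case 1
    have "Min (insert 0 (hi ` B)) - 1 < hi j" if "j \<in> B" for j
    proof -
      have "Min (insert 0 (hi ` B)) \<le> hi j" using fin that by (intro Min_le) auto
      then show ?thesis by simp
    qed
    then show ?thesis using 1 by (intro exI[of _ "Min (insert 0 (hi ` B)) - 1"]) (auto intro: less_imp_le)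
  next
    case 2
    have "lo i < Max (insert 0 (lo ` A)) + 1" if "i \<in> A" for i
    proof -
      have "lo i \<le> Max (insert 0 (lo ` A))" using fin that by (intro Max_ge) auto
      then show ?thesis by simp
    qed
    then show ?thesis using 2 by (intro exI[of _ "Max (insert 0 (lo ` A)) + 1"]) (auto intro: less_imp_le)
  next
    case 3
    define l h where "l = Max (lo ` A)" and "h = Min (hi ` B)"
    have "l \<in> lo ` A" "h \<in> hi ` B" unfolding l_def h_def using fin 3 by (auto intro!: Max_in Min_in)
    then obtain i0 j0 where ij: "i0 \<in> A" "l = lo i0" "j0 \<in> B" "h = hi j0" by blast
    have l: "lo i \<le> l" if "i \<in> A" for i unfolding l_def using fin that by (intro Max_ge) auto
    have h: "h \<le> hi j" if "j \<in> B" for j unfolding h_def using fin that by (intro Min_le) auto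
    have "l \<le> h" using le ij by simp
    show ?thesis
    proof (intro exI[of _ "(l + h) / 2"] conjI ballI impI)
      fix i assume i: "i \<in> A"
      show "lo i \<le> (l + h) / 2" using l[OF i] \<open>l \<le> h\<close> by simp
      show "lo i < (l + h) / 2" if "i \<in> S"
        using l[OF i] less[OF i ij(3)] that ij(4) \<open>l \<le> h\<close> by simp
    next
      fix j assume j: "j \<in> B"
      show "(l + h) / 2 \<le> hi j" using h[OF j] \<open>l \<le> h\<close> by simp
      show "(l + h) / 2 < hi j" if "j \<in> S"
        using h[OF j] less[OF ij(1) j] that ij(2) \<open>l \<le> h\<close> by simp
    qed
  qed
qed

definition form_value :: "'v set \<Rightarrow> ('v \<Rightarrow> int) \<Rightarrow> ('v \<Rightarrow> real) \<Rightarrow> real" where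
  "form_value V f r = (\<Sum>w\<in>V. of_int (f w) * r w)"

text \<open>
  Fourier-Motzkin elimination, with the usual certificate of infeasibility replaced by the total preorder with positive
  cone \<open>Q\<close>. To eliminate the variable \<open>v\<close>, a constraint with positive and one with negative coefficient at \<open>v\<close> are combined so
  that \<open>v\<close> cancels. The combination has the required sign for the preorder because the constraints have it, so the
  induction hypothesis applies; it then says that at the real point found so far every lower bound on the missing coordinate
  lies below every upper bound.
\<close>

lemma total_preorder_real_point:
  fixes Q :: "('v \<Rightarrow> int) set"
  assumes add: "\<And>f g. f \<in> Q \<Longrightarrow> g \<in> Q \<Longrightarrow> (\<lambda>w. f w + g w) \<in> Q"
    and total: "\<And>f. f \<in> Q \<or> (\<lambda>w. - f w) \<in> Q"
    and V: "finite V"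
  shows "finite F \<Longrightarrow> finite S \<Longrightarrow> F \<subseteq> Q \<Longrightarrow> (\<forall>f \<in> S. (\<lambda>w. - f w) \<notin> Q) \<Longrightarrow>
    (\<forall>f \<in> F \<union> S. \<forall>w. w \<notin> V \<longrightarrow> f w = 0) \<Longrightarrow>
    \<exists>r. (\<forall>f \<in> F. 0 \<le> form_value V f r) \<and> (\<forall>f \<in> S. 0 < form_value V f r)"
  using V
proof (induction V arbitrary: F S rule: finite_induct)
  case empty
  have zero: "(\<lambda>w. 0) \<in> Q" using total[of "\<lambda>w. 0"] by simp
  have "f = (\<lambda>w. 0)" if "f \<in> S" for f using empty.prems that by auto
  then have "S = {}" using zero empty.prems(4) by fastforce
  then show ?case by (simp add: form_value_def)
next
  case (insert v V)
  have zero: "(\<lambda>w. 0) \<in> Q" using total[of "\<lambda>w. 0"] by simp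
  have scale: "(\<lambda>w. k * f w) \<in> Q" if "f \<in> Q" "0 \<le> k" for f and k :: int
  proof -
    have "(\<lambda>w. int n * f w) \<in> Q" for n
    proof (induction n)
      case (Suc n)
      then show ?case using add[OF that(1) Suc] by (simp add: algebra_simps)
    qed (simp add: zero)
    then show ?thesis using that(2) by (metis nonneg_int_cases)
  qed
  have unscale: "f \<in> Q" if kf: "(\<lambda>w. k * f w) \<in> Q" and "0 < k" for f and k :: int
  proof (rule ccontr)
    assume "f \<notin> Q"
    then have "(\<lambda>w. (k - 1) * (- f w)) \<in> Q"
      using total[of f] that(2) by (intro scale[of "\<lambda>w. - f w"]) auto
    from add[OF this kf] show False using \<open>f \<notin> Q\<close> by (simp add: algebra_simps)
  qed
  define mix where "mix f g = (\<lambda>w. (- g v) * f w + f v * g w)" for f g :: "'v \<Rightarrow> int"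
  define pos neg where "pos = {f \<in> F \<union> S. 0 < f v}" and "neg = {f \<in> F \<union> S. f v < 0}"
  have FS: "f \<in> Q" if "f \<in> F \<union> S" for f using that insert.prems(3,4) total by blast
  have mix_Q: "mix f g \<in> Q" if "f \<in> pos" "g \<in> neg" for f g
    unfolding mix_def using that by (intro add scale FS) (auto simp: pos_def neg_def)
  have mix_strict: "(\<lambda>w. - mix f g w) \<notin> Q" if fg: "f \<in> pos" "g \<in> neg" and S: "f \<in> S \<or> g \<in> S" for f g
  proof
    assume "(\<lambda>w. - mix f g w) \<in> Q"
    have fQ: "(\<lambda>w. (- g v) * f w) \<in> Q" and gQ: "(\<lambda>w. f v * g w) \<in> Q"
      using fg scale[OF FS, of f "- g v"] scale[OF FS, of g "f v"] by (simp_all add: pos_def neg_def)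
    from add[OF \<open>(\<lambda>w. - mix f g w) \<in> Q\<close> gQ] add[OF \<open>(\<lambda>w. - mix f g w) \<in> Q\<close> fQ]
    have "(\<lambda>w. (- g v) * (- f w)) \<in> Q" "(\<lambda>w. f v * (- g w)) \<in> Q"
      by (simp_all add: mix_def algebra_simps)
    then have "(\<lambda>w. - f w) \<in> Q" "(\<lambda>w. - g w) \<in> Q"
      using fg unscale[of "- g v" "\<lambda>w. - f w"] unscale[of "f v" "\<lambda>w. - g w"]
      by (auto simp: pos_def neg_def)
    then show False using S insert.prems(4) by blast
  qed
  \<comment> \<open>The constraints on the remaining variables; a combination is strict as soon as one of its two parts is.\<close>
  define F' where "F' = {f \<in> F. f v = 0} \<union> (\<lambda>(f, g). mix f g) ` (pos \<times> neg)"
  define S' where "S' = {f \<in> S. f v = 0} \<union>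
    (\<lambda>(f, g). mix f g) ` {(f, g) \<in> pos \<times> neg. f \<in> S \<or> g \<in> S}"
  have fin: "finite pos" "finite neg" using insert.prems(1,2) by (auto simp: pos_def neg_def)
  have "\<exists>r. (\<forall>f \<in> F'. 0 \<le> form_value V f r) \<and> (\<forall>f \<in> S'. 0 < form_value V f r)"
  proof (rule insert.IH)
    show "finite F'" using fin insert.prems by (auto simp: F'_def)
    have "finite {(f, g) \<in> pos \<times> neg. f \<in> S \<or> g \<in> S}"
      by (rule finite_subset[of _ "pos \<times> neg"]) (use fin in auto)
    then show "finite S'" using insert.prems by (auto simp: S'_def)
    show "F' \<subseteq> Q" using insert.prems mix_Q by (auto simp: F'_def)
    show "\<forall>f \<in> S'. (\<lambda>w. - f w) \<notin> Q" using insert.prems mix_strict by (auto simp: S'_def)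
    have supp: "f w = 0" if "f \<in> F \<union> S" "w \<notin> V" "w \<noteq> v" for f w using that insert.prems by blast
    have "f w = 0" if "f \<in> F \<union> S" "f v = 0" "w \<notin> V" for f w
      using that supp by (cases "w = v") auto
    moreover have "mix f g v = 0" for f g by (simp add: mix_def)
    then have "mix f g w = 0" if "f \<in> F \<union> S" "g \<in> F \<union> S" "w \<notin> V" for f g w
      using that supp[of f w] supp[of g w] by (cases "w = v") (simp_all add: mix_def)
    ultimately show "\<forall>f \<in> F' \<union> S'. \<forall>w. w \<notin> V \<longrightarrow> f w = 0"
      by (auto simp: F'_def S'_def pos_def neg_def)
  qed
  then obtain r where rF: "\<And>f. f \<in> F' \<Longrightarrow> 0 \<le> form_value V f r"
    and rS: "\<And>f. f \<in> S' \<Longrightarrow> 0 < form_value V f r" by blast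
  have val_mix: "form_value V (mix f g) r = - of_int (g v) * form_value V f r + of_int (f v) * form_value V g r"
    for f g by (simp add: form_value_def mix_def sum_distrib_left sum_subtractf sum_negf algebra_simps)
  \<comment> \<open>The value of the coordinate \<open>v\<close> at which the form \<open>f\<close> vanishes.\<close>
  define bound where "bound f = - form_value V f r / of_int (f v)" for f
  have order_iff: "(bound f \<le> bound g \<longleftrightarrow> 0 \<le> form_value V (mix f g) r) \<and>
      (bound f < bound g \<longleftrightarrow> 0 < form_value V (mix f g) r)"
    if "f \<in> pos" "g \<in> neg" for f g
    using that by (auto simp: bound_def val_mix pos_def neg_def field_simps)
  have "\<exists>c. (\<forall>f \<in> pos. bound f \<le> c \<and> (f \<in> S \<longrightarrow> bound f < c)) \<and>
    (\<forall>g \<in> neg. c \<le> bound g \<and> (g \<in> S \<longrightarrow> c < bound g))"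
  proof (rule exists_between_bounds[OF fin])
    show "bound f \<le> bound g" if "f \<in> pos" "g \<in> neg" for f g
    proof -
      have "mix f g \<in> F'" using that by (auto simp: F'_def)
      then show ?thesis using order_iff[OF that] rF by blast
    qed
    show "bound f < bound g" if "f \<in> pos" "g \<in> neg" "f \<in> S \<or> g \<in> S" for f g
    proof -
      have "mix f g \<in> S'" using that by (auto simp: S'_def)
      then show ?thesis using order_iff[OF that(1,2)] rS by blast
    qed
  qed
  then obtain c where c: "\<And>f. f \<in> pos \<Longrightarrow> bound f \<le> c \<and> (f \<in> S \<longrightarrow> bound f < c)"
    "\<And>g. g \<in> neg \<Longrightarrow> c \<le> bound g \<and> (g \<in> S \<longrightarrow> c < bound g)" by blast
  have val: "form_value (insert v V) f (r(v := c)) = of_int (f v) * c + form_value V f r" for f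
  proof -
    have "(\<Sum>w\<in>V. of_int (f w) * (r(v := c)) w) = (\<Sum>w\<in>V. of_int (f w) * r w)"
      by (rule sum.cong) (use insert.hyps in auto)
    then show ?thesis using insert.hyps by (simp add: form_value_def)
  qed
  have "0 \<le> form_value (insert v V) f (r(v := c)) \<and>
      (f \<in> S \<longrightarrow> 0 < form_value (insert v V) f (r(v := c)))" if f: "f \<in> F \<union> S" for f
  proof -
    consider "f v = 0" | "f \<in> pos" | "f \<in> neg" using f by (force simp: pos_def neg_def)
    then show ?thesis
    proof cases
      case 1
      then show ?thesis unfolding val using f rF[of f] rS[of f]
        by (auto simp: F'_def S'_def intro: less_imp_le)
    next
      case 2
      then show ?thesis unfolding val using c(1)[OF 2]
        by (auto simp: bound_def pos_def field_simps)
    next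
      case 3
      then show ?thesis unfolding val using c(2)[OF 3]
        by (auto simp: bound_def neg_def field_simps)
    qed
  qed
  then show ?case by blast
qed

section \<open>Terms, and the transfer of identities from the reals\<close>

datatype (lvars: 'v) lterm =
  LVar 'v
| LZero
| LAdd "'v lterm" "'v lterm"
| LNeg "'v lterm"
| LJoin "'v lterm" "'v lterm"
| LMeet "'v lterm" "'v lterm"

primrec leval :: "'b lgroup \<Rightarrow> ('v \<Rightarrow> 'b) \<Rightarrow> 'v lterm \<Rightarrow> 'b" where
  "leval G a (LVar v) = a v"
| "leval G a LZero = \<one>\<^bsub>G\<^esub>"
| "leval G a (LAdd s t) = leval G a s \<otimes>\<^bsub>G\<^esub> leval G a t"
| "leval G a (LNeg t) = inv\<^bsub>G\<^esub> (leval G a t)"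
| "leval G a (LJoin s t) = leval G a s \<squnion>\<^bsub>lattice_of G\<^esub> leval G a t"
| "leval G a (LMeet s t) = leval G a s \<sqinter>\<^bsub>lattice_of G\<^esub> leval G a t"

lemma finite_lvars [simp]: "finite (lvars t)"
  by (induction t) auto

lemma leval_cong: "(\<And>v. v \<in> lvars t \<Longrightarrow> a v = b v) \<Longrightarrow> leval G a t = leval G b t"
  by (induction t) auto

lemma (in lgroup) leval_closed: "(\<And>v. v \<in> lvars t \<Longrightarrow> a v \<in> carrier G) \<Longrightarrow> leval G a t \<in> carrier G"
  by (induction t) auto

lemma unital_lhom_leval:
  assumes "lgroup G" "group H" and h: "h \<in> unital_lhom G u H v"
    and a: "\<And>w. w \<in> lvars t \<Longrightarrow> a w \<in> carrier G"
  shows "h (leval G a t) = leval H (\<lambda>w. h (a w)) t"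
proof -
  interpret lgroup G by fact
  interpret h: group_hom G H h
    using h assms by (intro group_hom.intro group_hom_axioms.intro is_group) (auto simp: unital_lhom_def)
  note lattice = unital_lhom_lattice[OF h]
  show ?thesis
    using a
  proof (induction t)
    case (LAdd s t) then show ?case using leval_closed[of s a] leval_closed[of t a] by simp
  next
    case (LNeg t) then show ?case using leval_closed[of t a] by simp
  next
    case (LJoin s t) then show ?case
      using leval_closed[of s a] leval_closed[of t a] by (simp add: lattice)
  next
    case (LMeet s t) then show ?case
      using leval_closed[of s a] leval_closed[of t a] by (simp add: lattice)
  qed simp_all
qed

lemma leval_real_scale:
  assumes "0 \<le> c"
  shows "leval real_lgroup (\<lambda>v. c * r v) t = c * leval real_lgroup r t"
  by (induction t) (use assms in \<open>auto simp: algebra_simps max_mult_distrib_left min_mult_distrib_left\<close>)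

lemma leval_real_zero: "leval real_lgroup (\<lambda>v. 0) t = 0"
  by (induction t) auto

context lgroup
begin

lemma generated_by_terms:
  assumes hull: "(\<lambda>H. lsubgroup H G) hull B = carrier G" and B: "B \<subseteq> carrier G" and g: "g \<in> carrier G"
  shows "\<exists>t. lvars t \<subseteq> B \<and> leval G id t = g"
proof -
  let ?K = "{leval G id t | t. lvars t \<subseteq> B}"
  have "subgroup ?K G"
  proof
    show "?K \<subseteq> carrier G" using B by (auto intro!: leval_closed)
    show "\<one> \<in> ?K" by (auto intro!: exI[of _ LZero])
    show "x \<otimes> y \<in> ?K" if xy: "x \<in> ?K" "y \<in> ?K" for x y
    proof -
      obtain s t where "x = leval G id s" "lvars s \<subseteq> B" "y = leval G id t" "lvars t \<subseteq> B"
        using xy by blast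
      then show ?thesis by (intro CollectI exI[of _ "LAdd s t"]) auto
    qed
    show "inv x \<in> ?K" if x: "x \<in> ?K" for x
    proof -
      obtain s where "x = leval G id s" "lvars s \<subseteq> B" using x by blast
      then show ?thesis by (intro CollectI exI[of _ "LNeg s"]) auto
    qed
  qed
  moreover have "x \<curlyvee> y \<in> ?K \<and> x \<curlywedge> y \<in> ?K" if xy: "x \<in> ?K" "y \<in> ?K" for x y
  proof -
    obtain s t where "x = leval G id s" "lvars s \<subseteq> B" "y = leval G id t" "lvars t \<subseteq> B"
      using xy by blast
    then have "x \<curlyvee> y = leval G id (LJoin s t)" "x \<curlywedge> y = leval G id (LMeet s t)"
      "lvars (LJoin s t) \<subseteq> B" "lvars (LMeet s t) \<subseteq> B" by simp_all
    then show ?thesis by blast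
  qed
  ultimately have "lsubgroup ?K G" unfolding lsubgroup_def by blast
  moreover have "B \<subseteq> ?K"
  proof
    fix b assume "b \<in> B"
    then show "b \<in> ?K" by (intro CollectI exI[of _ "LVar b"]) auto
  qed
  ultimately have "carrier G \<subseteq> ?K"
    using hull_minimal[of B ?K "\<lambda>H. lsubgroup H G"] hull by simp
  then show ?thesis using g by blast
qed

definition cone_le :: "'a set \<Rightarrow> 'a \<Rightarrow> 'a \<Rightarrow> bool" where
  "cone_le P x y \<longleftrightarrow> y \<otimes> inv x \<in> P"

lemma cone_le_of_le:
  assumes "lcone P" "x \<in> carrier G" "y \<in> carrier G" "x \<preceq> y"
  shows "cone_le P x y"
  using assms le_iff_one_le[of x y] by (simp add: cone_le_def lcone_def)

lemma cone_le_trans: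
  assumes "lcone P" "cone_le P x y" "cone_le P y z" "x \<in> carrier G" "y \<in> carrier G" "z \<in> carrier G"
  shows "cone_le P x z"
proof -
  have "(z \<otimes> inv y) \<otimes> (y \<otimes> inv x) \<in> P" using assms by (simp add: cone_le_def lcone_def)
  then show ?thesis using assms by (simp add: cone_le_def m_assoc)
qed

lemma cone_le_mult:
  assumes "lcone P" "cone_le P x y" "cone_le P x' y'"
    "x \<in> carrier G" "y \<in> carrier G" "x' \<in> carrier G" "y' \<in> carrier G"
  shows "cone_le P (x \<otimes> x') (y \<otimes> y')"
proof -
  have "(y \<otimes> inv x) \<otimes> (y' \<otimes> inv x') \<in> P" using assms by (simp add: cone_le_def lcone_def)
  then show ?thesis using assms by (simp add: cone_le_def inv_mult m_ac)
qed

lemma cone_le_inv: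
  assumes "cone_le P x y" "x \<in> carrier G" "y \<in> carrier G"
  shows "cone_le P (inv y) (inv x)"
  using assms by (simp add: cone_le_def m_comm)

lemma cone_le_meet_join:
  assumes "lcone P" "x \<in> carrier G" "y \<in> carrier G" "cone_le P y x"
  shows "cone_le P y (x \<curlywedge> y)" "cone_le P (x \<curlyvee> y) x"
  using lcone_meet_join[OF assms(1-3)] assms(4) by (simp_all add: cone_le_def)

lemma cone_le_linear:
  assumes "total_lcone P" "x \<in> carrier G" "y \<in> carrier G"
  shows "cone_le P x y \<or> cone_le P y x"
proof -
  have "inv (y \<otimes> inv x) = x \<otimes> inv y" using assms by (simp add: inv_mult m_comm)
  then show ?thesis using assms unfolding total_lcone_def cone_le_def by (metis inv_closed m_closed)
qed

definition lin_comb :: "'v set \<Rightarrow> ('v \<Rightarrow> 'a) \<Rightarrow> ('v \<Rightarrow> int) \<Rightarrow> 'a" where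
  "lin_comb V a f = (\<Otimes>v\<in>V. a v [^] f v)"

lemma lin_comb_closed [simp]:
  "(\<And>v. v \<in> V \<Longrightarrow> a v \<in> carrier G) \<Longrightarrow> lin_comb V a f \<in> carrier G"
  unfolding lin_comb_def by (rule finprod_closed) auto

lemma lin_comb_add:
  assumes "\<And>v. v \<in> V \<Longrightarrow> a v \<in> carrier G"
  shows "lin_comb V a (\<lambda>v. f v + g v) = lin_comb V a f \<otimes> lin_comb V a g"
proof -
  have "lin_comb V a (\<lambda>v. f v + g v) = (\<Otimes>v\<in>V. a v [^] f v \<otimes> a v [^] g v)"
    unfolding lin_comb_def using assms by (intro finprod_cong') (auto simp: int_pow_mult)
  also have "\<dots> = lin_comb V a f \<otimes> lin_comb V a g"
    unfolding lin_comb_def using assms by (intro finprod_multf) auto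
  finally show ?thesis .
qed

lemma lin_comb_zero [simp]: "lin_comb V a (\<lambda>v. 0) = \<one>"
  by (simp add: lin_comb_def)

lemma lin_comb_neg:
  assumes "\<And>v. v \<in> V \<Longrightarrow> a v \<in> carrier G"
  shows "lin_comb V a (\<lambda>v. - f v) = inv (lin_comb V a f)"
  using lin_comb_add[of V a "\<lambda>v. - f v" f] assms by (intro inv_equality[symmetric]) auto

lemma lin_comb_unit:
  assumes "finite V" "w \<in> V" "\<And>v. v \<in> V \<Longrightarrow> a v \<in> carrier G"
  shows "lin_comb V a (\<lambda>v. if w = v then 1 else 0) = a w"
proof -
  have "lin_comb V a (\<lambda>v. if w = v then 1 else 0) = (\<Otimes>v\<in>V. if w = v then a v else \<one>)"
    unfolding lin_comb_def using assms by (intro finprod_cong') auto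
  also have "\<dots> = a w" using assms by (intro finprod_singleton) auto
  finally show ?thesis .
qed

text \<open>
  In a totally ordered group a join or meet is one of its two arguments, so a term evaluates to one of the linear forms obtained
  by choosing an argument at each lattice operation. The set \<open>F\<close> records the comparisons that justified the choices: at
  every real point where they hold as well, the term is given by the same form \<open>L\<close>.
\<close>

lemma leval_linear_form:
  fixes a :: "'v \<Rightarrow> 'a"
  assumes P: "total_lcone P" and V: "finite V" and a: "\<And>v. v \<in> V \<Longrightarrow> a v \<in> carrier G"
  shows "lvars t \<subseteq> V \<Longrightarrow> \<exists>F L. finite F \<and> (\<forall>f \<in> insert L F. \<forall>w. w \<notin> V \<longrightarrow> f w = 0) \<and>
    (\<forall>f \<in> F. lin_comb V a f \<in> P) \<and>
    cone_le P (leval G a t) (lin_comb V a L) \<and> cone_le P (lin_comb V a L) (leval G a t) \<and>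
    (\<forall>r. (\<forall>f \<in> F. 0 \<le> form_value V f r) \<longrightarrow> leval real_lgroup r t = form_value V L r)"
  (is "_ \<Longrightarrow> \<exists>F L. ?T t F L")
proof (induction t)
  have lP: "lcone P" using P by (simp add: total_lcone_def)
  note [simp] = lin_comb_add[of V a] lin_comb_neg[of V a]
  have fv_add: "form_value V (\<lambda>w. f w + g w) r = form_value V f r + form_value V g r" for f g r
    by (simp add: form_value_def sum.distrib algebra_simps)
  have fv_neg: "form_value V (\<lambda>w. - f w) r = - form_value V f r" for f r
    by (simp add: form_value_def sum_negf)
  have refl: "cone_le P x x" if "x \<in> carrier G" for x using cone_le_of_le[OF lP that that] that by simp
  have cl: "lin_comb V a f \<in> carrier G" for f using a by simp
  have lattice_step: "(\<exists>F L. ?T (LJoin s t) F L) \<and> (\<exists>F L. ?T (LJoin t s) F L) \<and>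
      (\<exists>F L. ?T (LMeet s t) F L) \<and> (\<exists>F L. ?T (LMeet t s) F L)"
    if 1: "?T s F L" and 2: "?T t F' L'" and vars: "lvars (LJoin s t) \<subseteq> V"
      and le: "cone_le P (lin_comb V a L') (lin_comb V a L)" for s t F L F' L'
  proof -
    let ?x = "leval G a s" and ?y = "leval G a t" and ?D = "\<lambda>w. L w + - L' w"
    have c: "?x \<in> carrier G" "?y \<in> carrier G"
      using vars a by (auto intro!: leval_closed)
    have xL: "cone_le P ?x (lin_comb V a L)" "cone_le P (lin_comb V a L) ?x"
      and yL: "cone_le P ?y (lin_comb V a L')" "cone_le P (lin_comb V a L') ?y"
      using 1 2 by simp_all
    have xy: "?x \<curlyvee> ?y \<in> carrier G" "?x \<curlywedge> ?y \<in> carrier G" using c by simp_all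
    have "cone_le P ?y ?x"
      using cone_le_trans[OF lP cone_le_trans[OF lP yL(1) le] xL(2)] c cl by blast
    note m = cone_le_meet_join[OF lP c this]
    have m': "cone_le P ?x (?x \<curlyvee> ?y)" "cone_le P (?x \<curlywedge> ?y) ?y"
      using c xy by (simp_all add: cone_le_of_le[OF lP])
    have x: "cone_le P (?x \<curlyvee> ?y) (lin_comb V a L)" "cone_le P (lin_comb V a L) (?x \<curlyvee> ?y)"
      using cone_le_trans[OF lP m(2) xL(1)] cone_le_trans[OF lP xL(2) m'(1)] c cl xy by blast+
    have y: "cone_le P (?x \<curlywedge> ?y) (lin_comb V a L')" "cone_le P (lin_comb V a L') (?x \<curlywedge> ?y)"
      using cone_le_trans[OF lP m'(2) yL(1)] cone_le_trans[OF lP yL(2) m(1)] c cl xy by blast+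
    have "lin_comb V a ?D = lin_comb V a L \<otimes> inv (lin_comb V a L')"
      using lin_comb_add[of V a L "\<lambda>w. - L' w"] a by simp
    then have D: "lin_comb V a ?D \<in> P" using le by (simp add: cone_le_def)
    have ge: "form_value V L' r \<le> form_value V L r" if "0 \<le> form_value V ?D r" for r
      using that fv_add[of L "\<lambda>w. - L' w" r] by (simp add: fv_neg)
    have st: "?T (LJoin s t) (insert ?D (F \<union> F')) L" "?T (LMeet s t) (insert ?D (F \<union> F')) L'"
      using 1 2 D x y ge by (auto simp: max_def min_def intro: antisym)
    have ts: "?T (LJoin t s) (insert ?D (F \<union> F')) L" "?T (LMeet t s) (insert ?D (F \<union> F')) L'"
      using 1 2 D x y ge
      by (auto simp: max_def min_def join_comm[of _ ?y] meet_comm[of _ ?y] intro: antisym)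
    have "\<exists>F L. ?T (LJoin s t) F L" "\<exists>F L. ?T (LJoin t s) F L"
      "\<exists>F L. ?T (LMeet s t) F L" "\<exists>F L. ?T (LMeet t s) F L"
      by (rule exI, rule exI, rule st ts)+
    then show ?thesis by (intro conjI)
  qed
  {
    case (LVar v)
    let ?L = "\<lambda>w. if v = w then 1 else (0::int)"
    have "form_value V ?L r = r v" for r :: "'v \<Rightarrow> real"
      using LVar V by (simp add: form_value_def if_distrib[of of_int] if_distrib[of "\<lambda>x. x * _"] cong: if_cong)
    then have "?T (LVar v) {} ?L"
      using LVar a lin_comb_unit[OF V, of v a] refl by auto
    then show ?case by (intro exI)
  next
    case LZero
    have "?T LZero {} (\<lambda>w. 0)" using refl[of \<one>] by (simp add: form_value_def)
    then show ?case by (intro exI)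
  next
    case (LAdd s t)
    then have vars: "lvars s \<subseteq> V" "lvars t \<subseteq> V" by auto
    from LAdd.IH(1)[OF vars(1)] obtain F L where 1: "?T s F L" by (elim exE)
    from LAdd.IH(2)[OF vars(2)] obtain F' L' where 2: "?T t F' L'" by (elim exE)
    have c: "leval G a s \<in> carrier G" "leval G a t \<in> carrier G"
      using LAdd.prems a by (auto intro!: leval_closed)
    have "?T (LAdd s t) (F \<union> F') (\<lambda>w. L w + L' w)"
      using 1 2 c cl a by (auto simp: fv_add intro!: cone_le_mult[OF lP])
    then show ?case by (intro exI)
  next
    case (LNeg t)
    then have "lvars t \<subseteq> V" by simp
    from LNeg.IH[OF this] obtain F L where 1: "?T t F L" by (elim exE)
    have c: "leval G a t \<in> carrier G" using LNeg.prems a by (auto intro!: leval_closed)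
    have "?T (LNeg t) F (\<lambda>w. - L w)"
      using 1 c cl a by (auto simp: fv_neg intro!: cone_le_inv)
    then show ?case by (intro exI)
  next
    case (LJoin s t)
    then have vars: "lvars s \<subseteq> V" "lvars t \<subseteq> V" "lvars (LJoin s t) \<subseteq> V" "lvars (LJoin t s) \<subseteq> V"
      by auto
    from LJoin.IH(1)[OF vars(1)] obtain F L where 1: "?T s F L" by (elim exE)
    from LJoin.IH(2)[OF vars(2)] obtain F' L' where 2: "?T t F' L'" by (elim exE)
    from cone_le_linear[OF P cl cl, of L' L] show ?case
    proof
      assume "cone_le P (lin_comb V a L') (lin_comb V a L)"
      from lattice_step[OF 1 2 vars(3) this] show ?case by (elim conjE)
    next
      assume "cone_le P (lin_comb V a L) (lin_comb V a L')"
      from lattice_step[OF 2 1 vars(4) this] show ?case by (elim conjE)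
    qed
  next
    case (LMeet s t)
    then have vars: "lvars s \<subseteq> V" "lvars t \<subseteq> V" "lvars (LJoin s t) \<subseteq> V" "lvars (LJoin t s) \<subseteq> V"
      by auto
    from LMeet.IH(1)[OF vars(1)] obtain F L where 1: "?T s F L" by (elim exE)
    from LMeet.IH(2)[OF vars(2)] obtain F' L' where 2: "?T t F' L'" by (elim exE)
    from cone_le_linear[OF P cl cl, of L' L] show ?case
    proof
      assume "cone_le P (lin_comb V a L') (lin_comb V a L)"
      from lattice_step[OF 1 2 vars(3) this] show ?case by (elim conjE)
    next
      assume "cone_le P (lin_comb V a L) (lin_comb V a L')"
      from lattice_step[OF 2 1 vars(4) this] show ?case by (elim conjE)
    qed
  }
qed

text \<open>
  The relative form of Weinberg's theorem that the variety of abelian \<open>\<ell>\<close>-groups is generated by the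
  reals. A nonzero value \<open>y\<close> of the term is strictly negative, or \<open>- y\<close> is, for some total cone. The sign of the linear form that
  represents \<open>y\<close>, the recorded comparisons and the positivity of the variables are finitely many sign conditions; a real point
  satisfying them is nonnegative and the term does not vanish there.
\<close>

theorem leval_eq_one_if_real:
  fixes a :: "'v \<Rightarrow> 'a"
  assumes a: "\<And>v. v \<in> lvars t \<Longrightarrow> a v \<in> carrier G" and nonneg: "\<And>v. v \<in> lvars t \<Longrightarrow> \<one> \<preceq> a v"
    and real: "\<And>r. (\<And>v. 0 \<le> r v) \<Longrightarrow> leval real_lgroup r t = 0"
  shows "leval G a t = \<one>"
proof (rule ccontr)
  let ?y = "leval G a t" and ?V = "lvars t"
  assume "?y \<noteq> \<one>"
  have y: "?y \<in> carrier G" using a by (rule leval_closed)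
  have "\<not> (\<one> \<preceq> ?y \<and> \<one> \<preceq> inv ?y)"
    using \<open>?y \<noteq> \<one>\<close> y le_antisym[of ?y \<one>] inv_le_inv_iff[of \<one> ?y] by auto
  then obtain w where w: "w = ?y \<or> w = inv ?y" "\<not> \<one> \<preceq> w" by blast
  obtain P where P: "total_lcone P" "{x \<in> carrier G. \<one> \<preceq> x} \<subseteq> P" "w \<notin> P"
    using total_lcone_avoiding[OF lcone_nonneg, of w] w y by auto
  have lP: "lcone P" using P by (simp add: total_lcone_def)
  obtain F L where F: "finite F" "\<forall>f \<in> F. lin_comb ?V a f \<in> P"
    and supp: "\<forall>f \<in> insert L F. \<forall>w. w \<notin> ?V \<longrightarrow> f w = 0"
    and L: "cone_le P ?y (lin_comb ?V a L)" "cone_le P (lin_comb ?V a L) ?y"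
    and eval: "\<And>r. (\<forall>f \<in> F. 0 \<le> form_value ?V f r) \<Longrightarrow> leval real_lgroup r t = form_value ?V L r"
    using leval_linear_form[OF P(1), of ?V a t] a by auto
  define Q where "Q = {f. lin_comb ?V a f \<in> P}"
  define e where "e v = (\<lambda>w. if v = w then 1 else (0::int))" for v :: 'v
  have fv_e: "form_value ?V (e v) r = r v" if "v \<in> ?V" for v and r :: "'v \<Rightarrow> real"
    using that by (simp add: form_value_def e_def if_distrib[of of_int] if_distrib[of "\<lambda>x. x * _"] cong: if_cong)
  have e_Q: "e v \<in> Q" if "v \<in> ?V" for v
    using that a nonneg P(2) lin_comb_unit[of ?V v a] by (auto simp: Q_def e_def[abs_def])
  \<comment> \<open>The form representing the negative of \<open>w\<close>, which is strictly positive for \<open>P\<close>.\<close>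
  define K where "K = (if w = ?y then (\<lambda>v. - L v) else L)"
  have cl: "lin_comb ?V a f \<in> carrier G" for f using a by simp
  have K: "(\<lambda>v. - K v) \<notin> Q"
  proof
    assume "(\<lambda>v. - K v) \<in> Q"
    then have "lin_comb ?V a (\<lambda>v. - K v) \<in> P" by (simp add: Q_def)
    then have KP: "cone_le P \<one> (lin_comb ?V a (\<lambda>v. - K v))"
      using a by (simp add: cone_le_def)
    have "cone_le P (lin_comb ?V a (\<lambda>v. - K v)) w"
      using w L y cl a cone_le_inv[OF L(1)] by (auto simp: K_def lin_comb_neg)
    then have "cone_le P \<one> w" using cone_le_trans[OF lP KP] cl w y by auto
    then show False using P(3) w y by (auto simp: cone_le_def)
  qed
  have "\<exists>r. (\<forall>f \<in> F \<union> e ` ?V. 0 \<le> form_value ?V f r) \<and> (\<forall>f \<in> {K}. 0 < form_value ?V f r)"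
  proof (rule total_preorder_real_point[of Q])
    show "(\<lambda>w. f w + g w) \<in> Q" if "f \<in> Q" "g \<in> Q" for f g
      using that lP a by (simp add: Q_def lin_comb_add lcone_def)
    show "f \<in> Q \<or> (\<lambda>w. - f w) \<in> Q" for f
      using P(1) a cl[of f] by (simp add: Q_def lin_comb_neg total_lcone_def)
    show "F \<union> e ` ?V \<subseteq> Q" using F e_Q by (auto simp: Q_def)
    show "\<forall>f\<in>F \<union> e ` ?V \<union> {K}. \<forall>w. w \<notin> ?V \<longrightarrow> f w = 0"
      using supp by (auto simp: K_def e_def)
  qed (use F K in auto)
  then obtain r where r0: "\<forall>f \<in> F \<union> e ` ?V. 0 \<le> form_value ?V f r"
    and rK: "\<forall>f \<in> {K}. 0 < form_value ?V f r"
    by (elim exE conjE)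
  have rF: "\<forall>f \<in> F. 0 \<le> form_value ?V f r" using r0 by simp
  have rv: "0 \<le> r v" if "v \<in> ?V" for v
    using bspec[OF r0, of "e v"] fv_e[OF that, of r] that by simp
  \<comment> \<open>Nothing is known about \<open>r\<close> outside the variables of the term.\<close>
  define r' where "r' v = (if v \<in> ?V then r v else 0)" for v
  have "form_value ?V L r = leval real_lgroup r t" using eval[OF rF] by simp
  also have "\<dots> = leval real_lgroup r' t" by (rule leval_cong) (simp add: r'_def)
  also have "\<dots> = 0" using rv by (intro real) (simp add: r'_def)
  finally show False
    using rK by (auto simp: K_def form_value_def sum_negf split: if_splits)
qed

end

section \<open>Filling a simplex from its faces\<close>

lemma contractible_standard_simplex:
  "contractible_space (subtopology (powertop_real UNIV) (standard_simplex p))"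
proof -
  let ?S = "subtopology (powertop_real UNIV) (standard_simplex p)"
  \<comment> \<open>The straight-line homotopy to a vertex.\<close>
  let ?a = "\<lambda>j. if j = 0 then 1 else (0::real)"
  let ?h = "\<lambda>(t, x) i. (1 - t) * x i + t * ?a i"
  have "continuous_map (prod_topology (top_of_set {0..1}) ?S) (powertop_real UNIV) ?h"
    unfolding continuous_map_componentwise_UNIV case_prod_unfold
  proof
    fix k
    have "continuous_map (prod_topology (top_of_set {0..1}) ?S) euclideanreal fst"
      using continuous_map_fst continuous_map_into_fulltopology by blast
    moreover have "continuous_map (prod_topology (top_of_set {0..1}) ?S) euclideanreal (\<lambda>z. snd z k)"
    proof -
      have "continuous_map ?S euclideanreal (\<lambda>x. x k)"
        by (intro continuous_map_from_subtopology continuous_map_product_projection) simp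
      from continuous_map_compose[OF continuous_map_snd this] show ?thesis by (simp add: o_def)
    qed
    ultimately show "continuous_map (prod_topology (top_of_set {0..1}) ?S) euclideanreal
        (\<lambda>z. (1 - fst z) * snd z k + fst z * ?a k)"
      by (intro continuous_intros) auto
  qed
  moreover have "(\<lambda>i. (1 - t) * x i + t * ?a i) \<in> standard_simplex p"
    if "x \<in> standard_simplex p" "0 \<le> t" "t \<le> 1" for x and t :: real
    using that by (intro convex_standard_simplex) simp_all
  ultimately have "continuous_map (prod_topology (top_of_set {0..1}) ?S) ?S ?h"
    by (auto simp: continuous_map_in_subtopology)
  then have "homotopic_with (\<lambda>x. True) ?S ?S id (\<lambda>x. ?a)"
    unfolding homotopic_with_def by (intro exI[of _ ?h]) auto
  then show ?thesis unfolding contractible_space_def by blast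
qed

lemma continuous_map_real_Max:
  assumes "finite C" "C \<noteq> {}" "\<And>b. b \<in> C \<Longrightarrow> continuous_map X euclideanreal (f b)"
  shows "continuous_map X euclideanreal (\<lambda>x. Max ((\<lambda>b. f b x) ` C))"
  using assms
proof (induction rule: finite_ne_induct)
  case (insert b C)
  then have "continuous_map X euclideanreal (\<lambda>x. max (f b x) (Max ((\<lambda>b. f b x) ` C)))"
    by (intro continuous_map_real_max) auto
  then show ?case using insert by simp
qed simp

definition weighted_simplex :: "('i \<Rightarrow> real) \<Rightarrow> 'i set \<Rightarrow> ('i \<Rightarrow> real) set" where
  "weighted_simplex m C = {r. (\<forall>b. 0 \<le> r b) \<and> (\<forall>b. b \<notin> C \<longrightarrow> r b = 0) \<and> (\<Sum>b\<in>C. m b * r b) = 1}"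

text \<open>
  Radial projection from the interior point \<open>p\<close>, in both directions. The unit sphere of dimension \<open>n\<close> is identified with the set of
  directions in the hyperplane \<open>\<Sum> m b \<cdot> v b = 0\<close> by solving for the coordinate \<open>b0\<close>. Each direction leaves the simplex
  through its boundary, which is covered by \<open>E\<close>, so \<open>\<alpha>\<close> lifts to \<open>X\<close>; and \<open>\<beta>\<close>, the direction in which a point of \<open>X\<close> is
  seen from \<open>p\<close>, recovers the direction.
\<close>

lemma sphere_retract_of_punctured_simplex:
  fixes m p :: "'i \<Rightarrow> real" and X :: "'p topology" and E :: "'p \<Rightarrow> 'i \<Rightarrow> real"
  assumes card: "card C = n + 2" and m: "\<And>b. b \<in> C \<Longrightarrow> 0 < m b"
    and p: "p \<in> weighted_simplex m C" "\<And>b. b \<in> C \<Longrightarrow> 0 < p b"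
    and hom: "homeomorphic_map X (subtopology (powertop_real UNIV) (E ` topspace X)) E"
    and img: "E ` topspace X \<subseteq> weighted_simplex m C" "p \<notin> E ` topspace X"
    and bd: "\<And>b. b \<in> C \<Longrightarrow> weighted_simplex m (C - {b}) \<subseteq> E ` topspace X"
  shows "\<exists>\<beta>. retraction_map X (nsphere n) \<beta>"
proof -
  have fin: "finite C" using card by (simp add: card_ge_0_finite)
  obtain b0 where b0: "b0 \<in> C" using card by fastforce
  have "card (C - {b0}) = card {..n}" using card b0 fin by simp
  then obtain idx where idx: "bij_betw idx {..n} (C - {b0})"
    using fin by (metis finite_Diff finite_atMost finite_same_card_bij)
  define num where "num = the_inv_into {..n} idx"
  have num_idx: "num (idx i) = i" if "i \<le> n" for i
    unfolding num_def using that idx by (intro the_inv_into_f_f) (auto simp: bij_betw_def)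
  have idx_C: "idx i \<in> C" "idx i \<noteq> b0" if "i \<le> n" for i
    using bij_betwE[OF idx] that by auto
  have sum_idx: "(\<Sum>i\<le>n. f (idx i)) = (\<Sum>b\<in>C - {b0}. f b)" for f :: "'i \<Rightarrow> real"
    by (rule sum.reindex_bij_betw[OF idx])
  have split: "(\<Sum>b\<in>C. f b) = f b0 + (\<Sum>i\<le>n. f (idx i))" for f :: "'i \<Rightarrow> real"
    unfolding sum_idx using fin b0 by (rule sum.remove)
  define v where "v x b = (if b = b0 then - (\<Sum>i\<le>n. m (idx i) * x i) / m b0 else x (num b))"
    for x :: "nat \<Rightarrow> real" and b
  have v_idx: "v x (idx i) = x i" if "i \<le> n" for x i
    using idx_C[OF that] by (simp add: v_def num_idx[OF that])
  have v_sum: "(\<Sum>b\<in>C. m b * v x b) = 0" for x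
    using m[OF b0] by (simp add: split v_idx) (simp add: v_def)
  \<comment> \<open>The gauge of the simplex centred at \<open>p\<close>: the ray from \<open>p\<close> in direction \<open>v x\<close> leaves it at time \<open>1 / g x\<close>.\<close>
  define g where "g x = Max ((\<lambda>b. - v x b / p b) ` C)" for x
  have g_ge: "- v x b / p b \<le> g x" if "b \<in> C" for x b
    unfolding g_def using fin that by (intro Max_ge) auto
  have g_pos: "0 < g x" if x: "x \<in> topspace (nsphere n)" for x
  proof (rule ccontr)
    assume "\<not> 0 < g x"
    have "0 \<le> v x b" if "b \<in> C" for b
    proof -
      have "- v x b / p b \<le> 0" using g_ge[OF that, of x] \<open>\<not> 0 < g x\<close> by linarith
      then show ?thesis using p(2)[OF that] by (simp add: divide_le_0_iff zero_le_divide_iff)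
    qed
    then have "0 \<le> m b * v x b" if "b \<in> C" for b using m that by (simp add: less_imp_le)
    then have "\<forall>b\<in>C. m b * v x b = 0"
      using v_sum[of x] fin by (subst (asm) sum_nonneg_eq_0_iff) auto
    then have "x i = 0" if "i \<le> n" for i
      using m[OF idx_C(1)[OF that]] idx_C(1)[OF that] v_idx[OF that, of x] by force
    then show False using x by (simp add: nsphere)
  qed
  define \<alpha> where "\<alpha> x = (\<lambda>b. if b \<in> C then p b + v x b / g x else 0)" for x
  have \<alpha>_img: "\<alpha> x \<in> E ` topspace X" if x: "x \<in> topspace (nsphere n)" for x
  proof -
    note g = g_pos[OF x]
    have "g x \<in> (\<lambda>b. - v x b / p b) ` C" unfolding g_def using fin b0 by (intro Max_in) auto
    then obtain b where b: "b \<in> C" "g x = - v x b / p b" by blast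
    then have "\<alpha> x b = 0" using g p(2)[OF b(1)] by (simp add: \<alpha>_def field_simps)
    moreover have "0 \<le> \<alpha> x b" for b
    proof (cases "b \<in> C")
      case True
      then have "- v x b \<le> g x * p b" using g_ge[OF True, of x] p(2)[OF True] by (simp add: field_simps)
      then show ?thesis using True g by (simp add: \<alpha>_def field_simps)
    qed (simp add: \<alpha>_def)
    moreover have "(\<Sum>b\<in>C. m b * \<alpha> x b) = 1"
    proof -
      have "(\<Sum>b\<in>C. m b * \<alpha> x b) = (\<Sum>b\<in>C. m b * p b + (m b * v x b) / g x)"
        by (rule sum.cong) (auto simp: \<alpha>_def algebra_simps)
      also have "\<dots> = 1"
        using p(1) v_sum[of x] by (simp add: sum.distrib weighted_simplex_def flip: sum_divide_distrib)
      finally show ?thesis .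
    qed
    ultimately have "\<alpha> x \<in> weighted_simplex m (C - {b})"
      using fin b(1) sum.remove[OF fin b(1), of "\<lambda>b. m b * \<alpha> x b"]
      by (auto simp: weighted_simplex_def \<alpha>_def)
    then show ?thesis using bd b(1) by blast
  qed
  have proj: "continuous_map (nsphere n) euclideanreal (\<lambda>x. x k)" for k
    by (rule continuous_map_nsphere_projection)
  have cont_v: "continuous_map (nsphere n) euclideanreal (\<lambda>x. v x b)" for b
    unfolding v_def using m[OF b0] by (cases "b = b0") (auto intro!: continuous_intros proj)
  have cont_g: "continuous_map (nsphere n) euclideanreal g"
    unfolding g_def using fin b0 less_imp_neq[OF p(2), symmetric]
    by (intro continuous_map_real_Max) (auto intro!: continuous_intros cont_v)
  have "continuous_map (nsphere n) (powertop_real UNIV) \<alpha>"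
    unfolding continuous_map_componentwise_UNIV
  proof
    fix b
    show "continuous_map (nsphere n) euclideanreal (\<lambda>x. \<alpha> x b)"
    proof (cases "b \<in> C")
      case True
      have "continuous_map (nsphere n) euclideanreal (\<lambda>x. p b + v x b / g x)"
        by (intro continuous_intros cont_v cont_g) (use g_pos in force)
      then show ?thesis using True by (simp add: \<alpha>_def)
    qed (simp add: \<alpha>_def)
  qed
  then have cont_\<alpha>: "continuous_map (nsphere n) (subtopology (powertop_real UNIV) (E ` topspace X)) \<alpha>"
    using \<alpha>_img by (auto simp: continuous_map_in_subtopology)
  obtain E' where E': "homeomorphic_maps X (subtopology (powertop_real UNIV) (E ` topspace X)) E E'"
    using hom homeomorphic_map_maps by blast
  define N where "N y = sqrt (\<Sum>i\<le>n. (E y (idx i) - p (idx i))\<^sup>2)" for y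
  define \<beta> where "\<beta> y = (\<lambda>i. if i \<le> n then (E y (idx i) - p (idx i)) / N y else 0)" for y
  have N_pos: "0 < N y" if y: "y \<in> topspace X" for y
  proof (rule ccontr)
    assume "\<not> 0 < N y"
    then have "(\<Sum>i\<le>n. (E y (idx i) - p (idx i))\<^sup>2) = 0"
      by (simp add: N_def sum_nonneg order_antisym)
    then have eq: "E y (idx i) = p (idx i)" if "i \<le> n" for i
      using that by (subst (asm) sum_nonneg_eq_0_iff) auto
    have Ey: "E y \<in> weighted_simplex m C" using img y by blast
    then have "(\<Sum>b\<in>C. m b * E y b) = (\<Sum>b\<in>C. m b * p b)"
      using p(1) by (simp add: weighted_simplex_def)
    then have "m b0 * E y b0 = m b0 * p b0" unfolding split by (simp add: eq)
    then have "E y b0 = p b0" using m[OF b0] by simp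
    moreover have "E y b = p b" if "b \<in> C - {b0}" for b
      using eq that bij_betw_imp_surj_on[OF idx] by (metis atMost_iff imageE)
    moreover have "E y b = p b" if "b \<notin> C" for b
      using Ey p(1) that by (simp add: weighted_simplex_def)
    ultimately have "E y = p" by blast
    then show False using img(2) y by blast
  qed
  have cont_E: "continuous_map X euclideanreal (\<lambda>y. E y b)" for b
    using homeomorphic_imp_continuous_map[OF hom]
    by (simp add: continuous_map_in_subtopology continuous_map_componentwise_UNIV)
  have cont_N: "continuous_map X euclideanreal N"
    unfolding N_def by (intro continuous_map_sqrt continuous_intros cont_E) auto
  have "continuous_map X (powertop_real UNIV) \<beta>"
    unfolding continuous_map_componentwise_UNIV
  proof
    fix i
    show "continuous_map X euclideanreal (\<lambda>y. \<beta> y i)"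
    proof (cases "i \<le> n")
      case True
      have "continuous_map X euclideanreal (\<lambda>y. (E y (idx i) - p (idx i)) / N y)"
        by (intro continuous_intros cont_E cont_N) (use N_pos in force)
      then show ?thesis using True by (simp add: \<beta>_def)
    qed (simp add: \<beta>_def)
  qed
  moreover have "(\<Sum>i\<le>n. (\<beta> y i)\<^sup>2) = 1" if y: "y \<in> topspace X" for y
  proof -
    have "(\<Sum>i\<le>n. (\<beta> y i)\<^sup>2) = (\<Sum>i\<le>n. (E y (idx i) - p (idx i))\<^sup>2) / (N y)\<^sup>2"
      by (simp add: \<beta>_def power_divide sum_divide_distrib)
    also have "\<dots> = 1" using N_pos[OF y] by (simp add: N_def sum_nonneg)
    finally show ?thesis .
  qed
  ultimately have "continuous_map X (nsphere n) \<beta>"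
    by (auto simp: nsphere continuous_map_in_subtopology \<beta>_def)
  moreover have "continuous_map (nsphere n) X (E' \<circ> \<alpha>)"
    using E' by (intro continuous_map_compose[OF cont_\<alpha>]) (simp add: homeomorphic_maps_def)
  moreover have "\<beta> ((E' \<circ> \<alpha>) x) = x" if x: "x \<in> topspace (nsphere n)" for x
  proof -
    note g = g_pos[OF x]
    obtain y where y: "y \<in> topspace X" "\<alpha> x = E y" using \<alpha>_img[OF x] by blast
    then have "E' (E y) = y" using E' by (simp add: homeomorphic_maps_def)
    then have "E (E' (\<alpha> x)) = \<alpha> x" using y by simp
    then have diff: "E (E' (\<alpha> x)) (idx i) - p (idx i) = x i / g x" if "i \<le> n" for i
      using idx_C[OF that] v_idx[OF that, of x] by (simp add: \<alpha>_def)
    have "N (E' (\<alpha> x)) = sqrt (\<Sum>i\<le>n. (x i / g x)\<^sup>2)"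
      unfolding N_def by (intro arg_cong[of _ _ sqrt] sum.cong) (auto simp: diff)
    also have "(\<Sum>i\<le>n. (x i / g x)\<^sup>2) = (\<Sum>i\<le>n. (x i)\<^sup>2) / (g x)\<^sup>2"
      by (simp add: power_divide sum_divide_distrib)
    also have "(\<Sum>i\<le>n. (x i)\<^sup>2) = 1" using x by (simp add: nsphere)
    finally have "N (E' (\<alpha> x)) = 1 / g x" using g by (simp add: real_sqrt_divide)
    moreover have "x i = 0" if "\<not> i \<le> n" for i using x that by (simp add: nsphere)
    ultimately show ?thesis using g diff by (auto simp: \<beta>_def fun_eq_iff)
  qed
  ultimately show ?thesis unfolding retraction_map_def retraction_maps_def by blast
qed

text \<open>
  Induction over the faces \<open>C\<close>. For a vertex the preimage is a point, hence nonempty. In higher dimension the boundary is covered by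
  induction; if some interior point were not, the preimage of the face, which is contractible because it is homeomorphic to a
  simplex, would retract onto a sphere. Compactness makes \<open>E\<close> a homeomorphism onto its image there, which is what
  allows maps into the image to be lifted.
\<close>

theorem weighted_simplex_subset_image:
  fixes m :: "'i \<Rightarrow> real" and X :: "'p topology" and E :: "'p \<Rightarrow> 'i \<Rightarrow> real"
  assumes fin: "finite B" and m: "\<And>b. b \<in> B \<Longrightarrow> 0 < m b"
    and cont: "continuous_map X (powertop_real UNIV) E" and inj: "inj_on E (topspace X)"
    and img: "E ` topspace X \<subseteq> weighted_simplex m B"
    and faces: "\<And>C. C \<subseteq> B \<Longrightarrow> C \<noteq> {} \<Longrightarrow>
      subtopology X {x \<in> topspace X. \<forall>b \<in> B - C. E x b = 0} homeomorphic_space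
      subtopology (powertop_real UNIV) (standard_simplex (card C - 1))"
    and C: "C \<subseteq> B" "C \<noteq> {}"
  shows "weighted_simplex m C \<subseteq> E ` topspace X"
  using finite_subset[OF C(1) fin] C
proof (induction C rule: finite_psubset_induct)
  case (psubset C)
  let ?face = "{x \<in> topspace X. \<forall>b \<in> B - C. E x b = 0}"
  let ?Y = "subtopology X ?face"
  have top: "topspace ?Y = ?face" by auto
  note simplex = faces[OF psubset.prems]
  have mC: "0 < m b" if "b \<in> C" for b using m psubset.prems that by blast
  have face_img: "E x \<in> weighted_simplex m C" if "x \<in> ?face" for x
  proof -
    have "E x \<in> weighted_simplex m B" using img that by blast
    moreover have "(\<Sum>b\<in>B. m b * E x b) = (\<Sum>b\<in>C. m b * E x b)"
      using that fin psubset.prems by (intro sum.mono_neutral_right) auto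
    ultimately show ?thesis using that by (auto simp: weighted_simplex_def)
  qed
  have face_of: "x \<in> ?face" if "x \<in> topspace X" "E x \<in> weighted_simplex m D" "D \<subseteq> C" for x D
    using that by (auto simp: weighted_simplex_def)
  show ?case
  proof (rule ccontr)
    assume "\<not> ?case"
    then obtain p where p: "p \<in> weighted_simplex m C" "p \<notin> E ` topspace X" by blast
    have sub: "weighted_simplex m (C - {b}) \<subseteq> E ` ?face" if "b \<in> C" for b
    proof (cases "C - {b} = {}")
      case False
      then have "weighted_simplex m (C - {b}) \<subseteq> E ` topspace X"
        using psubset.IH[of "C - {b}"] psubset.prems that by blast
      then show ?thesis using face_of by blast
    next
      case True
      then show ?thesis unfolding True by (simp add: weighted_simplex_def)
    qed
    have pos: "0 < p b" if b: "b \<in> C" for b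
    proof (rule ccontr)
      assume "\<not> 0 < p b"
      then have "p b = 0" using p(1) by (simp add: weighted_simplex_def order_antisym)
      then have "p \<in> weighted_simplex m (C - {b})"
        using p(1) sum.remove[OF psubset.hyps b, of "\<lambda>b. m b * p b"] by (auto simp: weighted_simplex_def)
      then show False using sub[OF b] p(2) by blast
    qed
    show False
    proof (cases "card C = 1")
      case True
      then obtain b where Cb: "C = {b}" by (auto simp: card_1_singleton_iff)
      obtain h where "homeomorphic_map (subtopology (powertop_real UNIV) (standard_simplex (card C - 1))) ?Y h"
        using simplex homeomorphic_space homeomorphic_space_sym by blast
      then have "h ` standard_simplex (card C - 1) = ?face"
        using homeomorphic_imp_surjective_map top by fastforce
      then obtain x where x: "x \<in> ?face" using nonempty_standard_simplex by blast
      have "m b * E x b = m b * p b" "\<And>c. c \<noteq> b \<Longrightarrow> E x c = p c"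
        using face_img[OF x] p(1) by (auto simp: weighted_simplex_def Cb)
      then have "E x c = p c" for c using mC[of b] Cb by (cases "c = b") auto
      then have "E x = p" by blast
      then show False using p(2) x by blast
    next
      case False
      moreover have "card C \<noteq> 0" using psubset.hyps psubset.prems by simp
      ultimately obtain n where n: "card C = n + 2"
        by (metis One_nat_def add_2_eq_Suc' not0_implies_Suc)
      have "compact_space ?Y"
        using homeomorphic_compact_space[OF simplex] compactin_standard_simplex
        by (simp add: compact_space_subtopology)
      moreover have "Hausdorff_space (subtopology (powertop_real UNIV) (E ` topspace ?Y))"
        by (simp add: Hausdorff_space_product_topology Hausdorff_space_subtopology)
      moreover have "continuous_map ?Y (subtopology (powertop_real UNIV) (E ` topspace ?Y)) E"
        using cont by (auto simp: continuous_map_in_subtopology continuous_map_from_subtopology)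
      ultimately have "homeomorphic_map ?Y (subtopology (powertop_real UNIV) (E ` topspace ?Y)) E"
        using inj by (intro continuous_imp_homeomorphic_map) (auto simp: inj_on_def)
      then obtain \<beta> where "retraction_map ?Y (nsphere n) \<beta>"
        using sphere_retract_of_punctured_simplex[OF n mC p(1) pos, of ?Y E] face_img sub p(2)
        unfolding top by auto
      moreover have "contractible_space ?Y"
        using homeomorphic_space_contractibility[OF simplex] contractible_standard_simplex by blast
      ultimately have "contractible_space (nsphere n)"
        by (rule contractible_space_retraction_map_image)
      then show False using non_contractible_space_nsphere by blast
    qed
  qed
qed

section \<open>Inequalities tested in total preorders\<close>

context lgroup
begin

text \<open>
  The subdirect representation of \<open>\<ell>\<close>-groups in the form in which it is used below: an inequality may be checked in the total
  preorders given by total cones, where case distinctions are available.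
\<close>

lemma le_of_total_lcones:
  assumes c: "x \<in> carrier G" "y \<in> carrier G" and P: "\<And>P. total_lcone P \<Longrightarrow> cone_le P x y"
  shows "x \<preceq> y"
proof (rule ccontr)
  assume "\<not> x \<preceq> y"
  then have "y \<otimes> inv x \<notin> {z \<in> carrier G. \<one> \<preceq> z}" using c le_iff_one_le[of x y] by simp
  then obtain P where "total_lcone P" "y \<otimes> inv x \<notin> P"
    using total_lcone_avoiding[OF lcone_nonneg, of "y \<otimes> inv x"] c by auto
  then show False using P by (auto simp: cone_le_def)
qed

lemma cone_le_pow:
  assumes "lcone P" "x \<in> carrier G" "y \<in> carrier G" "cone_le P x y"
  shows "cone_le P (x [^] (k::nat)) (y [^] k)"
proof (induction k)
  case 0 show ?case using cone_le_of_le[OF assms(1), of \<one> \<one>] by simp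
next
  case (Suc k) then show ?case using assms by (auto intro: cone_le_mult)
qed

lemma pow_join_one_le:
  assumes c: "z \<in> carrier G" "r \<in> carrier G" and le: "z [^] (k::nat) \<preceq> r" "\<one> \<preceq> r"
  shows "(z \<curlyvee> \<one>) [^] k \<preceq> r"
proof (rule le_of_total_lcones)
  fix P assume P: "total_lcone P"
  then have lP: "lcone P" by (simp add: total_lcone_def)
  from cone_le_linear[OF P, of \<one> z] c have "cone_le P \<one> z \<or> cone_le P z \<one>" by simp
  then show "cone_le P ((z \<curlyvee> \<one>) [^] k) r"
  proof
    assume "cone_le P \<one> z"
    then have "cone_le P (z \<curlyvee> \<one>) z" using cone_le_meet_join(2)[OF lP, of z \<one>] c by simp
    then have "cone_le P ((z \<curlyvee> \<one>) [^] k) (z [^] k)" using lP c by (intro cone_le_pow) auto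
    then show ?thesis
      using cone_le_trans[OF lP _ cone_le_of_le[OF lP _ _ le(1)]] c by simp
  next
    assume "cone_le P z \<one>"
    then have "cone_le P (\<one> \<curlyvee> z) \<one>" using cone_le_meet_join(2)[OF lP, of \<one> z] c by simp
    then have "cone_le P ((z \<curlyvee> \<one>) [^] k) (\<one> [^] k)"
      using lP c by (intro cone_le_pow) (auto simp: join_comm)
    then show ?thesis
      using cone_le_trans[OF lP _ cone_le_of_le[OF lP _ _ le(2)]] c by simp
  qed
qed (use c in auto)

text \<open>
  For a total preorder, \<open>u \<le> 0\<close> would imply \<open>0 \<le> (n + 1) u \<le> u\<close>, so \<open>0 \<le> u\<close> in every case.
\<close>

lemma one_le_of_pow:
  assumes u: "u \<in> carrier G" and le: "\<one> \<preceq> u [^] Suc n"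
  shows "\<one> \<preceq> u"
proof (rule le_of_total_lcones)
  fix P assume P: "total_lcone P"
  then have lP: "lcone P" by (simp add: total_lcone_def)
  have refl: "cone_le P u u" using cone_le_of_le[OF lP, of u u] u by simp
  have one: "cone_le P \<one> (u [^] Suc n)" using cone_le_of_le[OF lP, of \<one>] u le by simp
  from cone_le_linear[OF P, of \<one> u] u have "cone_le P \<one> u \<or> cone_le P u \<one>" by simp
  then show "cone_le P \<one> u"
  proof
    assume "cone_le P u \<one>"
    then have "cone_le P (u [^] n) (\<one> [^] n)" using lP u by (intro cone_le_pow) auto
    then have "cone_le P (u [^] n \<otimes> u) (\<one> \<otimes> u)" using lP u refl by (intro cone_le_mult) auto
    then show ?thesis using cone_le_trans[OF lP one, of u] u by simp
  qed
qed (use u in auto)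

end

lemma (in unital_lgroup) one_le_unit: "\<one> \<preceq> u"
proof -
  obtain n :: nat where n: "inv u \<preceq> u [^] n"
    using order_unit[of "inv u"] unit_closed by auto
  then have "inv u \<otimes> u \<preceq> u [^] n \<otimes> u" using unit_closed by (subst le_mult_right_iff) auto
  then show ?thesis using unit_closed one_le_of_pow[of u n] by simp
qed

section \<open>Lifting bounded positive families\<close>

text \<open>
  Starting from any preimage \<open>x0\<close> of \<open>y\<close>, the excess \<open>d = (k x0 - r) \<squnion> 0\<close> lies in the kernel of \<open>\<psi>\<close>. Subtracting all of it
  from \<open>x0\<close>, instead of one \<open>k\<close>-th that may not exist, suffices: \<open>k (x0 - d) \<le> k x0 - d \<le> r\<close>, since \<open>d \<ge> 0\<close>
  and \<open>k \<ge> 1\<close>. Passing to the positive part of \<open>x0 - d\<close> keeps this bound because \<open>r \<ge> 0\<close>.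
\<close>

lemma lift_bounded:
  fixes k :: nat
  assumes A: "lgroup A" and H: "lgroup H" and psi: "\<psi> \<in> unital_lhom A a H b" "\<psi> ` carrier A = carrier H"
    and r: "r \<in> carrier A" "leq A \<one>\<^bsub>A\<^esub> r"
    and y: "y \<in> carrier H" "leq H \<one>\<^bsub>H\<^esub> y" "leq H (y [^]\<^bsub>H\<^esub> k) (\<psi> r)" and k: "1 \<le> k"
  shows "\<exists>x \<in> carrier A. leq A \<one>\<^bsub>A\<^esub> x \<and> leq A (x [^]\<^bsub>A\<^esub> k) r \<and> \<psi> x = y"
proof -
  interpret A: lgroup A by fact
  interpret H: lgroup H by fact
  interpret psi: group_hom A H \<psi> by (rule unital_lhom_group_hom[OF A H psi(1)])
  have "y \<in> \<psi> ` carrier A" using psi(2) y(1) by simp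
  then obtain x0 where x0: "x0 \<in> carrier A" "\<psi> x0 = y" by auto
  define e where "e = x0 [^]\<^bsub>A\<^esub> k \<otimes>\<^bsub>A\<^esub> inv\<^bsub>A\<^esub> r"
  define d where "d = e \<squnion>\<^bsub>lattice_of A\<^esub> \<one>\<^bsub>A\<^esub>"
  define z where "z = x0 \<otimes>\<^bsub>A\<^esub> inv\<^bsub>A\<^esub> d"
  have c: "e \<in> carrier A" "d \<in> carrier A" "z \<in> carrier A" using x0 r by (simp_all add: e_def d_def z_def)
  have d1: "leq A \<one>\<^bsub>A\<^esub> d" "leq A e d" using c by (simp_all add: d_def)
  have "\<psi> e = y [^]\<^bsub>H\<^esub> k \<otimes>\<^bsub>H\<^esub> inv\<^bsub>H\<^esub> (\<psi> r)" using x0 r by (simp add: e_def psi.hom_nat_pow)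
  then have "leq H (\<psi> e) \<one>\<^bsub>H\<^esub>" using y r by (simp add: H.mult_inv_le_iff)
  then have "\<psi> e \<squnion>\<^bsub>lattice_of H\<^esub> \<one>\<^bsub>H\<^esub> = \<one>\<^bsub>H\<^esub>"
    using c by (intro H.le_antisym H.join_least) auto
  then have "\<psi> d = \<one>\<^bsub>H\<^esub>" using c by (simp add: d_def unital_lhom_lattice[OF psi(1)])
  then have "\<psi> z = y" using x0 c y by (simp add: z_def)
  moreover have "y \<squnion>\<^bsub>lattice_of H\<^esub> \<one>\<^bsub>H\<^esub> = y" using y by (intro H.le_antisym H.join_least) auto
  ultimately have "\<psi> (z \<squnion>\<^bsub>lattice_of A\<^esub> \<one>\<^bsub>A\<^esub>) = y" using c by (simp add: unital_lhom_lattice[OF psi(1)])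
  moreover have "leq A (z [^]\<^bsub>A\<^esub> k) r"
  proof -
    obtain j where j: "k = Suc j" using k by (cases k) auto
    have dk: "leq A d (d [^]\<^bsub>A\<^esub> k)"
      using A.le_mult_mono[OF A.one_le_pow[OF d1(1) c(2), of j] A.le_refl[OF c(2)]] c by (simp add: j)
    have "leq A e (d [^]\<^bsub>A\<^esub> k)" by (rule A.le_trans[OF d1(2) dk]) (use c in auto)
    then have "leq A (x0 [^]\<^bsub>A\<^esub> k) (d [^]\<^bsub>A\<^esub> k \<otimes>\<^bsub>A\<^esub> r)"
      using x0 r c by (simp add: e_def A.mult_inv_le_iff)
    moreover have "z [^]\<^bsub>A\<^esub> k = x0 [^]\<^bsub>A\<^esub> k \<otimes>\<^bsub>A\<^esub> inv\<^bsub>A\<^esub> (d [^]\<^bsub>A\<^esub> k)"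
      using x0 c by (simp add: z_def A.nat_pow_distrib A.nat_pow_inv)
    ultimately show ?thesis using x0 r c by (simp add: A.mult_inv_le_iff A.m_comm)
  qed
  ultimately show ?thesis
    using A.pow_join_one_le[of z r k] c r
    by (intro bexI[of _ "z \<squnion>\<^bsub>lattice_of A\<^esub> \<one>\<^bsub>A\<^esub>"]) auto
qed

lemma (in lgroup) one_le_finprod:
  assumes "finite C" "\<And>b. b \<in> C \<Longrightarrow> f b \<in> carrier G" "\<And>b. b \<in> C \<Longrightarrow> \<one> \<preceq> f b"
  shows "\<one> \<preceq> (\<Otimes>b\<in>C. f b)"
  using assms
proof (induction C rule: finite_induct)
  case (insert b C)
  then have "(\<Otimes>b\<in>C. f b) \<in> carrier G" by (intro finprod_closed) auto
  then have "\<one> \<otimes> \<one> \<preceq> f b \<otimes> (\<Otimes>b\<in>C. f b)" using insert by (intro le_mult_mono) auto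
  moreover have "(\<Otimes>b\<in>insert b C. f b) = f b \<otimes> (\<Otimes>b\<in>C. f b)"
    using insert by (intro finprod_insert) auto
  ultimately show ?case by simp
qed simp

text \<open>
  After one element has been lifted, the bound for the remaining ones is what is left of \<open>r\<close>.
\<close>

lemma lift_family:
  fixes m :: "'i \<Rightarrow> nat" and y :: "'i \<Rightarrow> 'c"
  assumes A: "lgroup A" and H: "lgroup H" and psi: "\<psi> \<in> unital_lhom A a H b" "\<psi> ` carrier A = carrier H"
    and C: "finite C"
  shows "(\<And>c. c \<in> C \<Longrightarrow> y c \<in> carrier H \<and> leq H \<one>\<^bsub>H\<^esub> (y c) \<and> 1 \<le> m c) \<Longrightarrow>
    r \<in> carrier A \<Longrightarrow> leq A \<one>\<^bsub>A\<^esub> r \<Longrightarrow> leq H (\<Otimes>\<^bsub>H\<^esub>c\<in>C. y c [^]\<^bsub>H\<^esub> m c) (\<psi> r) \<Longrightarrow>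
    \<exists>x. (\<forall>c \<in> C. x c \<in> carrier A \<and> leq A \<one>\<^bsub>A\<^esub> (x c) \<and> \<psi> (x c) = y c) \<and>
      leq A (\<Otimes>\<^bsub>A\<^esub>c\<in>C. x c [^]\<^bsub>A\<^esub> m c) r"
  using C
proof (induction C arbitrary: r rule: finite_induct)
  case empty
  interpret A: lgroup A by fact
  show ?case using empty by simp
next
  case (insert c C)
  interpret A: lgroup A by fact
  interpret H: lgroup H by fact
  interpret psi: group_hom A H \<psi> by (rule unital_lhom_group_hom[OF A H psi(1)])
  have yC: "y d \<in> carrier H" "leq H \<one>\<^bsub>H\<^esub> (y d)" if "d \<in> insert c C" for d using insert.prems(1)[OF that] by auto
  let ?Y = "\<Otimes>\<^bsub>H\<^esub>d\<in>C. y d [^]\<^bsub>H\<^esub> m d" and ?yc = "y c [^]\<^bsub>H\<^esub> m c"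
  have Y: "?Y \<in> carrier H" "?yc \<in> carrier H" using yC by (auto intro!: H.finprod_closed)
  have "(\<Otimes>\<^bsub>H\<^esub>d\<in>insert c C. y d [^]\<^bsub>H\<^esub> m d) = ?yc \<otimes>\<^bsub>H\<^esub> ?Y"
    using insert.hyps yC by (intro H.finprod_insert) auto
  then have le: "leq H (?yc \<otimes>\<^bsub>H\<^esub> ?Y) (\<psi> r)" using insert.prems(4) by simp
  have "leq H \<one>\<^bsub>H\<^esub> ?Y" using insert.hyps yC by (intro H.one_le_finprod H.one_le_pow) auto
  then have "leq H (?yc \<otimes>\<^bsub>H\<^esub> \<one>\<^bsub>H\<^esub>) (?yc \<otimes>\<^bsub>H\<^esub> ?Y)" using Y by (subst H.le_mult_left_iff) auto
  then have "leq H ?yc (\<psi> r)"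
    using H.le_trans[OF _ le, of ?yc] Y insert.prems(2) by simp
  then obtain xc where xc: "xc \<in> carrier A" "leq A \<one>\<^bsub>A\<^esub> xc" "leq A (xc [^]\<^bsub>A\<^esub> m c) r" "\<psi> xc = y c"
    using lift_bounded[OF A H psi insert.prems(2,3), of "y c" "m c"] insert.prems(1)[of c] by blast
  define s where "s = r \<otimes>\<^bsub>A\<^esub> inv\<^bsub>A\<^esub> (xc [^]\<^bsub>A\<^esub> m c)"
  have s: "s \<in> carrier A" "leq A \<one>\<^bsub>A\<^esub> s" "\<psi> s = \<psi> r \<otimes>\<^bsub>H\<^esub> inv\<^bsub>H\<^esub> ?yc"
    using xc insert.prems(2) by (simp_all add: s_def A.le_mult_inv_iff psi.hom_nat_pow)
  have "leq H ?Y (\<psi> s)"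
    using le Y insert.prems(2) by (simp add: s(3) H.le_mult_inv_iff H.m_comm)
  then obtain x where x: "\<forall>d \<in> C. x d \<in> carrier A \<and> leq A \<one>\<^bsub>A\<^esub> (x d) \<and> \<psi> (x d) = y d"
    and xs: "leq A (\<Otimes>\<^bsub>A\<^esub>d\<in>C. x d [^]\<^bsub>A\<^esub> m d) s"
    using insert.IH[OF _ s(1,2)] insert.prems(1) by auto
  let ?x = "x(c := xc)"
  have "(\<Otimes>\<^bsub>A\<^esub>d\<in>C. ?x d [^]\<^bsub>A\<^esub> m d) = (\<Otimes>\<^bsub>A\<^esub>d\<in>C. x d [^]\<^bsub>A\<^esub> m d)"
    using insert.hyps x by (intro A.finprod_cong') auto
  moreover have "(\<Otimes>\<^bsub>A\<^esub>d\<in>insert c C. ?x d [^]\<^bsub>A\<^esub> m d) =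
      ?x c [^]\<^bsub>A\<^esub> m c \<otimes>\<^bsub>A\<^esub> (\<Otimes>\<^bsub>A\<^esub>d\<in>C. ?x d [^]\<^bsub>A\<^esub> m d)"
    using insert.hyps x xc by (intro A.finprod_insert) auto
  moreover have "(\<Otimes>\<^bsub>A\<^esub>d\<in>C. x d [^]\<^bsub>A\<^esub> m d) \<in> carrier A" using x by (auto intro!: A.finprod_closed)
  ultimately have "leq A (\<Otimes>\<^bsub>A\<^esub>d\<in>insert c C. ?x d [^]\<^bsub>A\<^esub> m d) r"
    using xs xc insert.prems(2) by (simp add: s_def A.le_mult_inv_iff A.m_comm)
  moreover have "\<forall>d \<in> insert c C. ?x d \<in> carrier A \<and> leq A \<one>\<^bsub>A\<^esub> (?x d) \<and> \<psi> (?x d) = y d"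
    using x xc by simp
  ultimately show ?case by blast
qed

section \<open>Coordinates on the maximal spectrum\<close>

context unital_lgroup
begin

definition real_char :: "'a set \<Rightarrow> 'a \<Rightarrow> real" where
  "real_char M = (SOME r. r \<in> unital_lhom G u real_lgroup 1 \<and> M = kernel G real_lgroup r)"

lemma
  assumes "M \<in> max_spec G u"
  shows real_char_unital_lhom: "real_char M \<in> unital_lhom G u real_lgroup 1"
    and real_char_kernel: "M = kernel G real_lgroup (real_char M)"
proof -
  have "\<exists>r. r \<in> unital_lhom G u real_lgroup 1 \<and> M = kernel G real_lgroup r"
    using max_spec_real_kernel[OF assms] by blast
  from someI_ex[OF this] show "real_char M \<in> unital_lhom G u real_lgroup 1"
    "M = kernel G real_lgroup (real_char M)"
    unfolding real_char_def by simp_all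
qed

lemma lgroup_G: "lgroup G"
  by unfold_locales

lemma lgroup_real: "lgroup real_lgroup"
  using unital_real_lgroup by (simp add: unital_lgroup_def)

lemma topspace_max_spec: "topspace (max_spec_topology G u) = max_spec G u"
proof -
  have "\<exists>a \<in> carrier G. a \<notin> M" if M: "M \<in> max_spec G u" for M
  proof -
    have "M \<subseteq> carrier G" using real_char_kernel[OF M] by (auto simp: kernel_def)
    moreover have "M \<noteq> carrier G" using M by (simp add: max_spec_def)
    ultimately show ?thesis by blast
  qed
  then show ?thesis
    unfolding max_spec_topology_def topology_generated_by_topspace by blast
qed

text \<open>
  For a rational bound \<open>p/q\<close> the set is a subbasic open set of the spectral topology: \<open>p/q < r g\<close> says that the positive part of
  \<open>q g - p u\<close> does not belong to the ideal.
\<close>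

lemma openin_real_char_greater:
  assumes g: "g \<in> carrier G"
  shows "openin (max_spec_topology G u) {M \<in> max_spec G u. c < real_char M g}"
proof -
  have rat: "openin (max_spec_topology G u) {M \<in> max_spec G u. d < real_char M g}" if d_rat: "d \<in> \<rat>" for d
  proof -
    obtain p q :: int where d: "d = of_int p / of_int q" "0 < q"
      using d_rat by (elim Rats_cases')
    define a where "a = (g [^] q \<otimes> inv (u [^] p)) \<curlyvee> \<one>"
    have a: "a \<in> carrier G" using g unit_closed by (simp add: a_def)
    have "a \<in> M \<longleftrightarrow> \<not> d < real_char M g" if M: "M \<in> max_spec G u" for M
    proof -
      note h = real_char_unital_lhom[OF M]
      interpret h: group_hom G real_lgroup "real_char M"
        by (rule unital_lhom_group_hom[OF lgroup_G lgroup_real h])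
      have "real_char M u = 1" using h by (simp add: unital_lhom_def)
      then have "real_char M a = max (of_int q * real_char M g - of_int p) 0"
        using g unit_closed by (simp add: a_def unital_lhom_lattice[OF h] h.hom_int_pow)
      moreover have "a \<in> M \<longleftrightarrow> real_char M a = 0"
        using a by (subst real_char_kernel[OF M]) (simp add: kernel_def)
      moreover have "d < real_char M g \<longleftrightarrow> of_int p < of_int q * real_char M g"
        using d by (simp add: pos_divide_less_eq mult.commute)
      ultimately show ?thesis by (auto simp: max_def)
    qed
    then have "{M \<in> max_spec G u. d < real_char M g} = max_spec G u - {M \<in> max_spec G u. a \<in> M}"
      by blast
    then show ?thesis
      unfolding max_spec_topology_def using a by (intro topology_generated_by_Basis) auto
  qed
  have "{M \<in> max_spec G u. c < real_char M g} =
      \<Union> {{M \<in> max_spec G u. d < real_char M g} | d. d \<in> \<rat> \<and> c \<le> d}"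
  proof (intro equalityI subsetI)
    fix M assume "M \<in> {M \<in> max_spec G u. c < real_char M g}"
    then obtain d where "d \<in> \<rat>" "c < d" "d < real_char M g" "M \<in> max_spec G u"
      using Rats_dense_in_real[of c "real_char M g"] by blast
    then show "M \<in> \<Union> {{M \<in> max_spec G u. d < real_char M g} | d. d \<in> \<rat> \<and> c \<le> d}"
      by (intro UnionI[of "{M \<in> max_spec G u. d < real_char M g}"]) auto
  qed auto
  then show ?thesis using rat by (auto intro!: openin_Union)
qed

lemma continuous_map_real_char:
  assumes g: "g \<in> carrier G"
  shows "continuous_map (max_spec_topology G u) euclideanreal (\<lambda>M. real_char M g)"
proof -
  have "real_char M (inv g) = - real_char M g" if M: "M \<in> max_spec G u" for M
  proof -
    interpret h: group_hom G real_lgroup "real_char M"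
      by (rule unital_lhom_group_hom[OF lgroup_G lgroup_real real_char_unital_lhom[OF M]])
    show ?thesis using h.hom_inv[OF g] by simp
  qed
  then have "{M \<in> max_spec G u. real_char M g < c} = {M \<in> max_spec G u. - c < real_char M (inv g)}" for c
    by auto
  then show ?thesis
    unfolding continuous_map_upper_lower_semicontinuous_lt topspace_max_spec
    using openin_real_char_greater[OF g] openin_real_char_greater[of "inv g"] g by simp
qed

end

lemma (in lgroup) Inf_subset_ne_one:
  assumes B: "finite B" "B \<subseteq> carrier G" "\<And>b. b \<in> B \<Longrightarrow> \<one> \<preceq> b"
    and C: "C \<subseteq> B" "C \<noteq> {}" and ne: "\<Sqinter>\<^bsub>lattice_of G\<^esub> B \<noteq> \<one>"
  shows "\<Sqinter>\<^bsub>lattice_of G\<^esub> C \<noteq> \<one>"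
proof
  assume one: "\<Sqinter>\<^bsub>lattice_of G\<^esub> C = \<one>"
  let ?i = "\<Sqinter>\<^bsub>lattice_of G\<^esub> B"
  have "greatest (lattice_of G) ?i (Lower (lattice_of G) B)"
    using B C by (intro order.finite_inf_greatest) auto
  then have i: "?i \<in> carrier G" "\<And>b. b \<in> B \<Longrightarrow> ?i \<preceq> b" "\<one> \<preceq> ?i"
    using B by (auto simp: greatest_def Lower_def)
  have "greatest (lattice_of G) (\<Sqinter>\<^bsub>lattice_of G\<^esub> C) (Lower (lattice_of G) C)"
    using B C by (intro order.finite_inf_greatest) (auto intro: finite_subset)
  moreover have "?i \<in> Lower (lattice_of G) C" using i B C by (auto simp: Lower_def)
  ultimately have "?i \<preceq> \<one>" unfolding one by (simp add: greatest_def)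
  then show False using i ne le_antisym[of ?i \<one>] by simp
qed

text \<open>
  The map sending a maximal ideal to the values of its real character on \<open>B\<close> has values in the simplex \<open>\<Sum> m b \<cdot> r b = 1\<close> because a character
  sends \<open>u\<close> to \<open>1\<close>, is injective because \<open>B\<close> generates \<open>G\<close>, and carries the sets of ideals containing \<open>B - C\<close> to the faces of
  the simplex. So it is onto by \<open>weighted_simplex_subset_image\<close>.
\<close>

theorem basis_real_point:
  assumes G: "unital_lgroup G u" and basis: "basis G u B"
    and inf: "\<Sqinter>\<^bsub>lattice_of G\<^esub> B \<noteq> \<one>\<^bsub>G\<^esub>" and mult: "multiplicities G u B m" and ne: "B \<noteq> {}"
    and r: "r \<in> weighted_simplex (\<lambda>b. real (m b)) B"
  shows "\<exists>h \<in> unital_lhom G u real_lgroup 1. \<forall>b \<in> B. h b = r b"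
proof -
  interpret unital_lgroup G u by fact
  have B: "finite B" "B \<subseteq> carrier G" "\<And>b. b \<in> B \<Longrightarrow> \<one>\<^bsub>G\<^esub> \<preceq> b"
    and hull: "(\<lambda>H. lsubgroup H G) hull B = carrier G"
    using basis by (auto simp: basis_def)
  define E where "E M b = (if b \<in> B then real_char M b else 0)" for M b
  let ?X = "max_spec_topology G u"
  have "weighted_simplex (\<lambda>b. real (m b)) B \<subseteq> E ` topspace ?X"
  proof (rule weighted_simplex_subset_image[where B = B])
    show "0 < real (m b)" if "b \<in> B" for b
      using mult that by (force simp: multiplicities_def)
    show "continuous_map ?X (powertop_real UNIV) E"
      unfolding continuous_map_componentwise_UNIV
    proof
      fix b show "continuous_map ?X euclideanreal (\<lambda>M. E M b)"
        using continuous_map_real_char[of b] B(2) by (cases "b \<in> B") (auto simp: E_def)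
    qed
    show "inj_on E (topspace ?X)"
      unfolding topspace_max_spec
    proof (rule inj_onI)
      fix M N assume M: "M \<in> max_spec G u" and N: "N \<in> max_spec G u" and eq: "E M = E N"
      have agree: "real_char M b = real_char N b" if "b \<in> B" for b
        using fun_cong[OF eq, of b] that by (simp add: E_def)
      have "real_char M g = real_char N g" if "g \<in> carrier G" for g
      proof -
        obtain t where t: "lvars t \<subseteq> B" "leval G id t = g"
          using generated_by_terms[OF hull B(2) \<open>g \<in> carrier G\<close>] by blast
        have "group real_lgroup" using comm_group_real_lgroup by (simp add: comm_group_def)
        note ev = unital_lhom_leval[OF lgroup_G this, where a = id and t = t]
        have c: "id w \<in> carrier G" if "w \<in> lvars t" for w using t B(2) that by auto
        have "real_char M g = leval real_lgroup (\<lambda>b. real_char M (id b)) t"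
          using ev[OF real_char_unital_lhom[OF M] c] t by simp
        also have "\<dots> = leval real_lgroup (\<lambda>b. real_char N (id b)) t"
          using t agree by (intro leval_cong) auto
        also have "\<dots> = real_char N g"
          using ev[OF real_char_unital_lhom[OF N] c] t by simp
        finally show ?thesis .
      qed
      then have "kernel G real_lgroup (real_char M) = kernel G real_lgroup (real_char N)"
        by (auto simp: kernel_def)
      then show "M = N" using real_char_kernel[OF M] real_char_kernel[OF N] by simp
    qed
    show "E ` topspace ?X \<subseteq> weighted_simplex (\<lambda>b. real (m b)) B"
      unfolding topspace_max_spec
    proof (rule image_subsetI)
      fix M assume M: "M \<in> max_spec G u"
      note h = real_char_unital_lhom[OF M]
      interpret h: group_hom G real_lgroup "real_char M"
        by (rule unital_lhom_group_hom[OF lgroup_G lgroup_real h])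
      have "0 \<le> real_char M b" if "b \<in> B" for b
        using unital_lhom_mono[OF lgroup_G lgroup_real h, of "\<one>\<^bsub>G\<^esub>" b] B that by auto
      moreover have "(\<Sum>b\<in>B. real (m b) * real_char M b) = 1"
      proof -
        have "real_char M u = (\<Otimes>\<^bsub>real_lgroup\<^esub>b\<in>B. real_char M b [^]\<^bsub>real_lgroup\<^esub> m b)"
          using hom_finprod_pow[OF comm_group_axioms comm_group_real_lgroup h.homh B(1), of "\<lambda>b. b" m] B(2) mult
          by (auto simp: multiplicities_def)
        then show ?thesis using h B(1) by (simp add: finprod_real_lgroup unital_lhom_def)
      qed
      ultimately show "E M \<in> weighted_simplex (\<lambda>b. real (m b)) B"
        by (auto simp: weighted_simplex_def E_def)
    qed
    fix C assume C: "C \<subseteq> B" "C \<noteq> {}"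
    have "card C \<ge> 1" using C B(1) by (metis One_nat_def Suc_leI card_gt_0_iff finite_subset)
    moreover have "\<Sqinter>\<^bsub>lattice_of G\<^esub> C \<noteq> \<one>\<^bsub>G\<^esub>" by (rule Inf_subset_ne_one[OF B C inf])
    ultimately have "subtopology ?X {M \<in> max_spec G u. B - C \<subseteq> M} homeomorphic_space
        subtopology (powertop_real UNIV) (standard_simplex (card C - 1))"
      using basis C(1) unfolding basis_def by blast
    moreover have "{M \<in> topspace ?X. \<forall>b \<in> B - C. E M b = 0} = {M \<in> max_spec G u. B - C \<subseteq> M}"
    proof -
      have "b \<in> M \<longleftrightarrow> E M b = 0" if M: "M \<in> max_spec G u" and "b \<in> B" for M b
        using that B(2) by (subst real_char_kernel[OF M]) (auto simp: kernel_def E_def)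
      then show ?thesis unfolding topspace_max_spec by blast
    qed
    ultimately show "subtopology ?X {M \<in> topspace ?X. \<forall>b \<in> B - C. E M b = 0} homeomorphic_space
        subtopology (powertop_real UNIV) (standard_simplex (card C - 1))" by simp
  qed (use B ne in auto)
  then obtain M where M: "M \<in> max_spec G u" "r = E M" using r topspace_max_spec by auto
  then show ?thesis using real_char_unital_lhom[OF M(1)] by (intro bexI[of _ "real_char M"]) (simp_all add: E_def)
qed

section \<open>The universal property of the basis, and projectivity\<close>

text \<open>
  A term vanishing at \<open>B\<close> vanishes at every real point of the simplex, hence at all nonnegative real points by homogeneity,
  hence at \<open>x\<close> in \<open>A\<close>. Applied to differences of terms this makes the value at \<open>x\<close> of a term representing \<open>g\<close> depend on \<open>g\<close>
  alone.
\<close>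

theorem basis_extension:
  fixes G :: "'a lgroup" and A :: "'b lgroup"
  assumes G: "unital_lgroup G u" and basis: "basis G u B"
    and inf: "\<Sqinter>\<^bsub>lattice_of G\<^esub> B \<noteq> \<one>\<^bsub>G\<^esub>" and mult: "multiplicities G u B m" and ne: "B \<noteq> {}"
    and A: "lgroup A" and x: "\<And>b. b \<in> B \<Longrightarrow> x b \<in> carrier A" "\<And>b. b \<in> B \<Longrightarrow> leq A \<one>\<^bsub>A\<^esub> (x b)"
  obtains \<theta> where "\<theta> \<in> unital_lhom G u A (\<Otimes>\<^bsub>A\<^esub>b\<in>B. x b [^]\<^bsub>A\<^esub> m b)" "\<And>b. b \<in> B \<Longrightarrow> \<theta> b = x b"
proof -
  interpret unital_lgroup G u by fact
  interpret A: lgroup A by fact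
  have B: "finite B" "B \<subseteq> carrier G"
    and hull: "(\<lambda>H. lsubgroup H G) hull B = carrier G"
    using basis by (auto simp: basis_def)
  have m: "0 < m b" if "b \<in> B" for b using mult that by (force simp: multiplicities_def)
  have real: "leval real_lgroup r t = 0"
    if t: "lvars t \<subseteq> B" "leval G id t = \<one>\<^bsub>G\<^esub>" and r: "\<And>b. 0 \<le> r b" for t and r :: "'a \<Rightarrow> real"
  proof -
    define s where "s = (\<Sum>b\<in>B. real (m b) * r b)"
    show ?thesis
    proof (cases "s = 0")
      case True
      then have "\<forall>b \<in> B. real (m b) * r b = 0"
        unfolding s_def using B(1) r by (subst (asm) sum_nonneg_eq_0_iff) auto
      then have "leval real_lgroup r t = leval real_lgroup (\<lambda>b. 0) t"
        using t m by (intro leval_cong) fastforce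
      then show ?thesis by (simp add: leval_real_zero)
    next
      case False
      then have s: "0 < s" using r by (simp add: s_def sum_nonneg order.strict_iff_order)
      define q where "q b = (if b \<in> B then r b / s else 0)" for b
      have "(\<Sum>b\<in>B. real (m b) * q b) = 1"
        using s by (simp add: q_def s_def flip: sum_divide_distrib)
      then have "q \<in> weighted_simplex (\<lambda>b. real (m b)) B"
        using r s by (auto simp: weighted_simplex_def q_def)
      then obtain h where h: "h \<in> unital_lhom G u real_lgroup 1" "\<forall>b \<in> B. h b = q b"
        using basis_real_point[OF G basis inf mult ne] by blast
      interpret h: group_hom G real_lgroup h
        by (rule unital_lhom_group_hom[OF lgroup_G lgroup_real h(1)])
      have "leval real_lgroup q t = leval real_lgroup (\<lambda>b. h (id b)) t"
        using t h(2) by (intro leval_cong) auto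
      also have "\<dots> = h (leval G id t)"
        using t B(2) by (intro unital_lhom_leval[OF lgroup_G _ h(1), symmetric]) auto
      also have "\<dots> = 0" using t(2) by simp
      finally have "leval real_lgroup (\<lambda>b. s * q b) t = 0" using s by (simp add: leval_real_scale)
      moreover have "leval real_lgroup (\<lambda>b. s * q b) t = leval real_lgroup r t"
        using t s by (intro leval_cong) (auto simp: q_def)
      ultimately show ?thesis by simp
    qed
  qed
  have transfer: "leval A x s = leval A x t"
    if s: "lvars s \<subseteq> B" and t: "lvars t \<subseteq> B" and eq: "leval G id s = leval G id t" for s t
  proof -
    have c: "leval A x s \<in> carrier A" "leval A x t \<in> carrier A" "leval G id t \<in> carrier G"
      using s t x(1) B(2) by (auto intro!: A.leval_closed leval_closed)
    have "leval A x (LAdd s (LNeg t)) = \<one>\<^bsub>A\<^esub>"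
      using s t x c eq by (intro A.leval_eq_one_if_real real) auto
    then show ?thesis using c A.inv_equality[of "leval A x s" "inv\<^bsub>A\<^esub> (leval A x t)"] by simp
  qed
  define term_of where "term_of g = (SOME t. lvars t \<subseteq> B \<and> leval G id t = g)" for g
  have term_of: "lvars (term_of g) \<subseteq> B" "leval G id (term_of g) = g" if "g \<in> carrier G" for g
    using someI_ex[OF generated_by_terms[OF hull B(2) that]] by (simp_all add: term_of_def)
  define \<theta> where "\<theta> g = leval A x (term_of g)" for g
  have \<theta>: "\<theta> (leval G id t) = leval A x t" if t: "lvars t \<subseteq> B" for t
  proof -
    have "leval G id t \<in> carrier G" using t B(2) by (auto intro!: leval_closed)
    then show ?thesis unfolding \<theta>_def by (intro transfer term_of t)
  qed
  have \<theta>_b: "\<theta> b = x b" if "b \<in> B" for b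
    using \<theta>[of "LVar b"] that by simp
  have \<theta>_ops: "\<theta> (g \<otimes>\<^bsub>G\<^esub> h) = \<theta> g \<otimes>\<^bsub>A\<^esub> \<theta> h"
      "\<theta> (g \<squnion>\<^bsub>lattice_of G\<^esub> h) = \<theta> g \<squnion>\<^bsub>lattice_of A\<^esub> \<theta> h"
      "\<theta> (g \<sqinter>\<^bsub>lattice_of G\<^esub> h) = \<theta> g \<sqinter>\<^bsub>lattice_of A\<^esub> \<theta> h"
    if "g \<in> carrier G" "h \<in> carrier G" for g h
    using \<theta>[of "LAdd (term_of g) (term_of h)"] \<theta>[of "LJoin (term_of g) (term_of h)"]
      \<theta>[of "LMeet (term_of g) (term_of h)"] term_of[OF that(1)] term_of[OF that(2)]
    by (simp_all add: \<theta>_def)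
  have "\<theta> g \<in> carrier A" if "g \<in> carrier G" for g
    unfolding \<theta>_def using term_of[OF that] x(1) by (auto intro!: A.leval_closed)
  then have hom: "\<theta> \<in> hom G A" using \<theta>_ops(1) by (simp add: hom_def)
  have "\<theta> u = (\<Otimes>\<^bsub>A\<^esub>b\<in>B. \<theta> b [^]\<^bsub>A\<^esub> m b)"
    using hom_finprod_pow[OF comm_group_axioms A.comm_group_axioms hom B(1), of "\<lambda>b. b" m] B(2) mult
    by (auto simp: multiplicities_def)
  also have "\<dots> = (\<Otimes>\<^bsub>A\<^esub>b\<in>B. x b [^]\<^bsub>A\<^esub> m b)"
    using x(1) \<theta>_b by (intro A.finprod_cong') auto
  finally have "\<theta> \<in> unital_lhom G u A (\<Otimes>\<^bsub>A\<^esub>b\<in>B. x b [^]\<^bsub>A\<^esub> m b)"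
    using hom \<theta>_ops by (simp add: unital_lhom_def)
  then show thesis using \<theta>_b by (rule that)
qed

theorem theorem4p2:
  fixes G :: "'a lgroup" and u :: 'a and B :: "'a set" and m :: "'a \<Rightarrow> nat"
  assumes "unital_lgroup G u"
    and "basis G u B"
    and "\<Sqinter>\<^bsub>lattice_of G\<^esub> B \<noteq> \<one>\<^bsub>G\<^esub>"
    and "multiplicities G u B m"
    and "\<exists>b \<in> B. m b = 1"
  shows "projective TYPE('b) TYPE('c) G u"
  unfolding projective_def
proof (intro allI impI, elim conjE)
  fix A :: "'b lgroup" and a and H :: "'c lgroup" and v \<psi> \<phi>
  assume A: "unital_lgroup A a" and H: "unital_lgroup H v"
    and psi: "\<psi> \<in> unital_lhom A a H v" "\<psi> ` carrier A = carrier H" and phi: "\<phi> \<in> unital_lhom G u H v"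
  interpret unital_lgroup G u by fact
  interpret A: unital_lgroup A a by fact
  interpret H: unital_lgroup H v by fact
  have lA: "lgroup A" and lH: "lgroup H" by unfold_locales
  interpret psi: group_hom A H \<psi> by (rule unital_lhom_group_hom[OF lA lH psi(1)])
  interpret phi: group_hom G H \<phi> by (rule unital_lhom_group_hom[OF lgroup_G lH phi])
  have B: "finite B" "B \<subseteq> carrier G" "\<And>b. b \<in> B \<Longrightarrow> \<one>\<^bsub>G\<^esub> \<preceq> b"
    and hull: "(\<lambda>H. lsubgroup H G) hull B = carrier G"
    using assms(2) by (auto simp: basis_def)
  have m: "1 \<le> m b" if "b \<in> B" for b using assms(4) that by (auto simp: multiplicities_def)
  obtain b0 where b0: "b0 \<in> B" "m b0 = 1" using assms(5) by blast
  define C where "C = B - {b0}"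
  have BC: "B = insert b0 C" "b0 \<notin> C" "finite C" using b0 B by (auto simp: C_def)
  have phi_B: "\<phi> b \<in> carrier H" "leq H \<one>\<^bsub>H\<^esub> (\<phi> b)" if "b \<in> B" for b
    using unital_lhom_mono[OF lgroup_G lH phi, of "\<one>\<^bsub>G\<^esub>" b] B that by auto
  let ?Y = "\<Otimes>\<^bsub>H\<^esub>b\<in>C. \<phi> b [^]\<^bsub>H\<^esub> m b"
  have Y: "?Y \<in> carrier H" using phi_B BC by (auto intro!: H.finprod_closed)
  have "v = (\<Otimes>\<^bsub>H\<^esub>b\<in>B. \<phi> b [^]\<^bsub>H\<^esub> m b)"
    using hom_finprod_pow[OF comm_group_axioms H.comm_group_axioms phi.homh B(1), of "\<lambda>b. b" m] B(2) assms(4) phi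
    by (auto simp: multiplicities_def unital_lhom_def)
  also have "\<dots> = \<phi> b0 \<otimes>\<^bsub>H\<^esub> ?Y"
    unfolding BC(1) using BC phi_B b0 by (subst H.finprod_insert) auto
  finally have v: "v = \<phi> b0 \<otimes>\<^bsub>H\<^esub> ?Y" .
  have psi_a: "\<psi> a = v" using psi(1) by (simp add: unital_lhom_def)
  have "leq H (\<one>\<^bsub>H\<^esub> \<otimes>\<^bsub>H\<^esub> ?Y) (\<phi> b0 \<otimes>\<^bsub>H\<^esub> ?Y)"
    using phi_B[OF b0(1)] Y by (subst H.le_mult_right_iff) auto
  then have "leq H ?Y (\<psi> a)" using v psi_a Y by simp
  moreover have "\<phi> b \<in> carrier H \<and> leq H \<one>\<^bsub>H\<^esub> (\<phi> b) \<and> 1 \<le> m b" if "b \<in> C" for b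
    using that phi_B m BC(1) by simp
  ultimately have "\<exists>x. (\<forall>b \<in> C. x b \<in> carrier A \<and> leq A \<one>\<^bsub>A\<^esub> (x b) \<and> \<psi> (x b) = \<phi> b) \<and>
      leq A (\<Otimes>\<^bsub>A\<^esub>b\<in>C. x b [^]\<^bsub>A\<^esub> m b) a"
    using A.unit_closed A.one_le_unit by (intro lift_family[OF lA lH psi BC(3)])
  then obtain x where xC: "\<forall>b \<in> C. x b \<in> carrier A \<and> leq A \<one>\<^bsub>A\<^esub> (x b) \<and> \<psi> (x b) = \<phi> b"
    and xle: "leq A (\<Otimes>\<^bsub>A\<^esub>b\<in>C. x b [^]\<^bsub>A\<^esub> m b) a"
    by (elim exE conjE)
  note x = bspec[OF xC]
  let ?X = "\<Otimes>\<^bsub>A\<^esub>b\<in>C. x b [^]\<^bsub>A\<^esub> m b"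
  have X: "?X \<in> carrier A" using x by (auto intro!: A.finprod_closed)
  have "\<psi> ?X = (\<Otimes>\<^bsub>H\<^esub>b\<in>C. \<psi> (x b) [^]\<^bsub>H\<^esub> m b)"
    using x by (intro hom_finprod_pow[OF A.comm_group_axioms H.comm_group_axioms psi.homh BC(3)]) auto
  also have "\<dots> = ?Y" using x phi_B BC by (intro H.finprod_cong') auto
  finally have psi_X: "\<psi> ?X = ?Y" .
  \<comment> \<open>The equation \<open>\<Sum> m b \<cdot> y b = a\<close> solved for the element of multiplicity \<open>1\<close>.\<close>
  define y where "y = x(b0 := a \<otimes>\<^bsub>A\<^esub> inv\<^bsub>A\<^esub> ?X)"
  have y0: "y b0 \<in> carrier A" "leq A \<one>\<^bsub>A\<^esub> (y b0)" "\<psi> (y b0) = \<phi> b0"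
    using X xle A.unit_closed Y phi_B[OF b0(1)]
    by (simp_all add: y_def A.le_mult_inv_iff psi_a psi_X) (simp add: v H.m_assoc)
  have yB: "y b \<in> carrier A \<and> leq A \<one>\<^bsub>A\<^esub> (y b) \<and> \<psi> (y b) = \<phi> b" if "b \<in> B" for b
  proof (cases "b = b0")
    case False
    then have "b \<in> C" "y b = x b" using that by (auto simp: C_def y_def)
    then show ?thesis using x by simp
  qed (use y0 in simp)
  have "(\<Otimes>\<^bsub>A\<^esub>b\<in>B. y b [^]\<^bsub>A\<^esub> m b) = y b0 \<otimes>\<^bsub>A\<^esub> (\<Otimes>\<^bsub>A\<^esub>b\<in>C. y b [^]\<^bsub>A\<^esub> m b)"
    unfolding BC(1) using BC yB b0 y0 by (subst A.finprod_insert) auto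
  also have "(\<Otimes>\<^bsub>A\<^esub>b\<in>C. y b [^]\<^bsub>A\<^esub> m b) = ?X"
    using BC x by (intro A.finprod_cong') (auto simp: y_def)
  also have "y b0 \<otimes>\<^bsub>A\<^esub> ?X = a"
    using X A.unit_closed by (simp add: y_def A.m_assoc)
  finally have y_sum: "(\<Otimes>\<^bsub>A\<^esub>b\<in>B. y b [^]\<^bsub>A\<^esub> m b) = a" .
  have "B \<noteq> {}" using b0 by blast
  obtain \<theta> where \<theta>: "\<theta> \<in> unital_lhom G u A a" and \<theta>_b: "\<And>b. b \<in> B \<Longrightarrow> \<theta> b = y b"
    by (rule basis_extension[OF assms(1-4) \<open>B \<noteq> {}\<close> lA, of y]) (use yB in \<open>simp_all add: y_sum\<close>)
  have "\<phi> g = \<psi> (\<theta> g)" if g: "g \<in> carrier G" for g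
  proof -
    obtain t where t: "lvars t \<subseteq> B" "leval G id t = g"
      using generated_by_terms[OF hull B(2) g] by blast
    then have c: "\<And>w. w \<in> lvars t \<Longrightarrow> id w \<in> carrier G" "\<And>w. w \<in> lvars t \<Longrightarrow> \<theta> (id w) \<in> carrier A"
      using B(2) \<theta>_b yB by auto
    have "\<phi> g = leval H (\<lambda>b. \<phi> (id b)) t"
      using unital_lhom_leval[OF lgroup_G H.is_group phi, where a = id and t = t] c t(2) by simp
    also have "\<dots> = leval H (\<lambda>b. \<psi> (\<theta> (id b))) t"
      using t(1) \<theta>_b yB by (intro leval_cong) auto
    also have "\<dots> = \<psi> (leval A (\<lambda>b. \<theta> (id b)) t)"
      using unital_lhom_leval[OF lA H.is_group psi(1), where a = "\<lambda>b. \<theta> (id b)" and t = t] c by simp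
    also have "leval A (\<lambda>b. \<theta> (id b)) t = \<theta> g"
      using unital_lhom_leval[OF lgroup_G A.is_group \<theta>, where a = id and t = t] c t(2) by simp
    finally show ?thesis .
  qed
  then show "\<exists>\<theta> \<in> unital_lhom G u A a. \<forall>g \<in> carrier G. \<phi> g = \<psi> (\<theta> g)" using \<theta> by blast
qed

end
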